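(* Let $\eta,L\in\mathbb{R}$, and let $F_L(\eta,\cdot)$ be the regular Coulomb wave function. The following claims hold true. (i) If either $\eta\neq0$, $L>-3/2$ and $L\neq-1$, or $\eta=0$ and $L>-3/2$, then all zeros of $F_{L}(\eta,\cdot)$ are real. (ii) If $L<-3/2$ and, in addition, $L\notin-\mathbb{N}/2$ in the case $\eta\neq0$, respectively $L\notin-\mathbb{N}-1/2$ in the case $\eta=0$, then $F_{L}(\eta,\cdot)$ has exactly $\lfloor -L-1/2\rfloor$ distinct pairs of complex conjugate (non-real) zeros and an infinite number of real zeros.
   Context: $\mathbb{N}$ denotes the set of positive integers, $\mathbb{N}_0=\{0\}\cup\mathbb{N}$, $-\mathbb{N}/2=\{-\tfrac12,-1,-\tfrac32,\dots\}$ and $-\mathbb{N}-1/2=\{-\tfrac32,-\tfrac52,\dots\}$. The regular Coulomb wave function is $$F_{L}(\eta,\rho)=C_{L}(\eta)\,\rho^{L+1}\,\phi_{L}(\eta,\rho),\qquad C_{L}(\eta)=\frac{2^{L}e^{-\pi\eta/2}\,|\Gamma(L+1+\mathrm{i}\eta)|}{\Gamma(2L+2)},$$ where $$\phi_{L}(\eta,\rho)=e^{-\mathrm{i}\rho}\,{}_{1}F_{1}(L+1-\mathrm{i}\eta;2L+2;2\mathrm{i}\rho),\qquad {}_{1}F_{1}(a;b;z)=\sum_{n=0}^{\infty}\frac{(a)_{n}}{(b)_{n}}\frac{z^{n}}{n!}\quad(b\notin-\mathbb{N}_0),$$ with $(a)_0=1$ and $(a)_n=a(a+1)\cdots(a+n-1)$.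 For $L\notin-(\mathbb{N}+1)/2$, $\phi_L(\eta,\cdot)$ is an entire function of $\rho$ with $\phi_L(\eta,0)=1$. For $\eta=0$ one has $$\phi_{L}(0,\rho)=\Gamma(L+\tfrac32)\left(\frac{2}{\rho}\right)^{L+1/2}J_{L+1/2}(\rho),$$ with $J_\nu$ the Bessel function of the first kind; when $\eta=0$, this formula is taken as the definition of the entire function $\phi_L(0,\cdot)$ for all $L\notin-\mathbb{N}-1/2$, including negative integers $L$. With the possible exception of the origin, the zeros of $F_L(\eta,\cdot)$ are, by this decomposition, the zeros of the entire function $\phi_L(\eta,\cdot)$ in $\mathbb{C}$. *)

theory Defs
  imports "HOL-Analysis.Analysis"
begin

definition kummer_1F1 :: "complex \<Rightarrow> complex \<Rightarrow> complex \<Rightarrow> complex" where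
  "kummer_1F1 a b z = (\<Sum>n. pochhammer a n / pochhammer b n * (z ^ n / fact n))"

(* Bessel function of the first kind, on the principal branch of (z/2) powr \<nu>.  The reciprocal
   Gamma function rGamma is entire, so no \<nu> has to be excluded. *)
definition bessel_J :: "complex \<Rightarrow> complex \<Rightarrow> complex" where
  "bessel_J \<nu> z =
     (z / 2) powr \<nu> * (\<Sum>m. (-1) ^ m / fact m * rGamma (\<nu> + of_nat m + 1) * (z / 2) ^ (2 * m))"

(* For \<eta> = 0 the factor (2/\<rho>)^(L+1/2) is read as (\<rho>/2)^(-(L+1/2)), on the same branch as in
   bessel_J.  The branches then cancel, also on the negative real axis, and with the value 1 at
   the origin this is the entire function of lemma coulomb_phi_eta_0. *)
definition coulomb_phi :: "real \<Rightarrow> real \<Rightarrow> complex \<Rightarrow> complex" where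
  "coulomb_phi L \<eta> \<rho> =
     (if \<eta> = 0 then
        (if \<rho> = 0 then 1
         else of_real (Gamma (L + 3/2)) * (\<rho> / 2) powr (- of_real (L + 1/2))
                * bessel_J (of_real (L + 1/2)) \<rho>)
      else exp (- \<i> * \<rho>)
             * kummer_1F1 (of_real (L + 1) - \<i> * of_real \<eta>) (of_real (2 * L + 2)) (2 * \<i> * \<rho>))"

(* For \<eta> = 0 and L a negative integer, Gamma has a pole in both the numerator and the denominator.
   The value is then given by the duplication formula
   2^L Gamma(L+1) / Gamma(2L+2) = sqrt pi / (2^(L+1) Gamma(L+3/2));
   because of the modulus it is the limit in L only up to sign, which does not affect zeros. *)
definition coulomb_C :: "real \<Rightarrow> real \<Rightarrow> real" where
  "coulomb_C L \<eta> =
     (if \<eta> = 0 \<and> L + 1 \<in> \<int>\<^sub>\<le>\<^sub>0 then sqrt pi / (2 powr (L + 1) * Gamma (L + 3/2))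
      else 2 powr L * exp (- pi * \<eta> / 2) * cmod (Gamma (of_real (L + 1) + \<i> * of_real \<eta>))
             / Gamma (2 * L + 2))"

(* Principal branch of \<rho> powr (L+1).  At \<rho> = 0, where F_L(\<eta>, .) may be singular, 0 powr a = 0
   makes the value 0; away from the origin the zeros are those of coulomb_phi,
   see lemma coulomb_F_eq_0_iff. *)
definition coulomb_F :: "real \<Rightarrow> real \<Rightarrow> complex \<Rightarrow> complex" where
  "coulomb_F L \<eta> \<rho> = of_real (coulomb_C L \<eta>) * \<rho> powr of_real (L + 1) * coulomb_phi L \<eta> \<rho>"

lemma coulomb_phi_eta_0:
  assumes "L + 3/2 \<notin> \<int>\<^sub>\<le>\<^sub>0"
  shows "coulomb_phi L 0 \<rho> = of_real (Gamma (L + 3/2)) *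
           (\<Sum>m. (-1) ^ m / fact m * rGamma (of_real (L + 1/2) + of_nat m + 1) * (\<rho> / 2) ^ (2 * m))"
proof (cases "\<rho> = 0")
  case False
  have "(\<rho> / 2) powr (- of_real (L + 1/2)) * (\<rho> / 2) powr of_real (L + 1/2) = 1"
    using False by (simp flip: powr_add)
  then show ?thesis
    using False unfolding coulomb_phi_def bessel_J_def
    by (metis (no_types, lifting) mult.assoc mult.left_neutral)
next
  case True
  let ?f = "\<lambda>m. (-1) ^ m / fact m * rGamma (of_real (L + 1/2) + of_nat m + 1) * (\<rho> / 2) ^ (2 * m)"
  have "(\<Sum>m. ?f m) = (\<Sum>m\<in>{0}. ?f m)"
    by (rule suminf_finite) (auto simp: True)
  also have "\<dots> = rGamma (of_real (L + 3/2))"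
    by (simp add: add.assoc)
  finally have "(\<Sum>m. ?f m) = of_real (rGamma (L + 3/2))"
    by (simp only: rGamma_complex_of_real)
  moreover have "Gamma (L + 3/2) * rGamma (L + 3/2) = 1"
    using assms by (simp add: Gamma_def rGamma_eq_zero_iff)
  ultimately show ?thesis
    by (simp add: coulomb_phi_def True del: of_real_add flip: of_real_mult)
qed

lemma coulomb_C_nonzero:
  assumes "\<eta> \<noteq> 0 \<and> 2 * L + 2 \<notin> \<int>\<^sub>\<le>\<^sub>0 \<or> \<eta> = 0 \<and> L + 3/2 \<notin> \<int>\<^sub>\<le>\<^sub>0"
  shows "coulomb_C L \<eta> \<noteq> 0"
proof (cases "\<eta> = 0 \<and> L + 1 \<in> \<int>\<^sub>\<le>\<^sub>0")
  case True
  then show ?thesis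
    using assms by (auto simp: coulomb_C_def Gamma_eq_zero_iff)
next
  case False
  have "of_real (L + 1) + \<i> * of_real \<eta> \<notin> (\<int>\<^sub>\<le>\<^sub>0 :: complex set)"
  proof
    assume "of_real (L + 1) + \<i> * of_real \<eta> \<in> (\<int>\<^sub>\<le>\<^sub>0 :: complex set)"
    then obtain n where n: "of_real (L + 1) + \<i> * of_real \<eta> = (- of_nat n :: complex)"
      by (elim nonpos_Ints_cases') auto
    from arg_cong[OF n, of Im] arg_cong[OF n, of Re] have "\<eta> = 0" "L + 1 = - of_nat n"
      by simp_all
    then show False
      using False by auto
  qed
  moreover have "2 * L + 2 \<notin> \<int>\<^sub>\<le>\<^sub>0"
  proof (cases "\<eta> = 0")
    case True
    show ?thesis
    proof
      assume "2 * L + 2 \<in> \<int>\<^sub>\<le>\<^sub>0"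
      then obtain n where n: "2 * L + 2 = - real n"
        by (elim nonpos_Ints_cases') auto
      show False
      proof (cases "even n")
        case True
        then obtain k where "n = 2 * k" by blast
        with n have "L + 1 = - real k" by simp
        then show False using False \<open>\<eta> = 0\<close> by auto
      next
        case odd: False
        then obtain k where "n = 2 * k + 1" by (elim oddE)
        with n have "L + 3/2 = - real k" by simp
        then show False using assms \<open>\<eta> = 0\<close> by auto
      qed
    qed
  qed (use assms in auto)
  ultimately show ?thesis
    using False by (auto simp: coulomb_C_def Gamma_eq_zero_iff)
qed

lemma coulomb_F_eq_0_iff:
  assumes "\<eta> \<noteq> 0 \<and> 2 * L + 2 \<notin> \<int>\<^sub>\<le>\<^sub>0 \<or> \<eta> = 0 \<and> L + 3/2 \<notin> \<int>\<^sub>\<le>\<^sub>0" "\<rho> \<noteq> 0"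
  shows "coulomb_F L \<eta> \<rho> = 0 \<longleftrightarrow> coulomb_phi L \<eta> \<rho> = 0"
  using coulomb_C_nonzero[OF assms(1)] assms(2) by (simp add: coulomb_F_def)

end

(* The functions y k = z^k phi_(L+k) satisfy a three-term recurrence, so at a zero z of phi_L they
   form an eigenvector, with eigenvalue 1/z, of a tridiagonal operator that is symmetric for a
   diagonal form.  All weights of this form are positive if L > -3/2; if L < -3/2, exactly the first
   s = floor (-L - 1/2) of them are positive and the others negative.  Eigenvectors at zeros in the
   upper half plane span a neutral subspace, so there are at most s of them (and none if
   L > -3/2).

   For the converse, the moments of the operator are, up to the negative factor lower_d, the power
   sums of the reciprocal zeros with exponents >= 2 (Hadamard), because y 1 / y 0 is essentially the
   logarithmic derivative of phi_L.  Hence the Hankel matrix of the moments is minus the Gram form of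
   the reciprocal zeros.  Its leading s x s block is positive definite; with fewer than s zeros in
   the upper half plane, a suitable polynomial takes real values at all of them and makes the same
   form nonpositive.  All Hankel matrices being regular, there are infinitely many zeros. *)
theory Submission
  imports Defs "HOL-Complex_Analysis.Complex_Analysis" "HOL-Real_Asymp.Real_Asymp"
begin

section \<open>Taylor coefficients and contiguous relations\<close>

text \<open>The threshold -3/2 enters through two signs. \<open>ladder_c L \<eta> k\<close> has the
  sign of (2(L+k)+1)(2(L+k)+3), which is negative for at most one k >= 1, the one with -3/2 < L+k <
  -1/2; so the weights change sign at most once. And \<open>lower_d L \<eta>\<close> has the sign of
  2L+3. The form being indefinite for L < -3/2, no spectral theorem is invoked: orthogonality is a
  limit of partial sums, and the moments are limits of power sums over growing discs. Exponent 1 has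
  to be avoided there, since an entire function of exponential type need not have absolutely
  summable reciprocal zeros; hence the test polynomials in 1/z have no constant term, and their
  squares start at exponent 2. The power sums run over sets of zeros, without multiplicities, which
  is legitimate because all zeros are simple. At \<eta> = 0 negative integers L are allowed although
  the Kummer series is then undefined. For this reason everything rests on real Taylor coefficients
  that serve both definitions.\<close>

definition admissible :: "real \<Rightarrow> real \<Rightarrow> bool" where
  "admissible L \<eta> \<longleftrightarrow> \<eta> \<noteq> 0 \<and> 2 * L + 2 \<notin> \<int>\<^sub>\<le>\<^sub>0 \<or> \<eta> = 0 \<and> L + 3/2 \<notin> \<int>\<^sub>\<le>\<^sub>0"

lemma admissible_add: "admissible L \<eta> \<Longrightarrow> admissible (L + real k) \<eta>"
proof (induction k)
  case (Suc k)
  have 1: "x \<notin> \<int>\<^sub>\<le>\<^sub>0 \<Longrightarrow> x + 1 \<notin> \<int>\<^sub>\<le>\<^sub>0" for x :: real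
    using plus_one_in_nonpos_Ints_imp by blast
  have "2 * (L + real k) + 2 \<notin> \<int>\<^sub>\<le>\<^sub>0 \<Longrightarrow> 2 * (L + real (Suc k)) + 2 \<notin> \<int>\<^sub>\<le>\<^sub>0"
    using 1[of "2 * (L + real k) + 2"] 1[of "2 * (L + real k) + 3"] by (simp add: algebra_simps)
  moreover have "L + real k + 3/2 \<notin> \<int>\<^sub>\<le>\<^sub>0 \<Longrightarrow> L + real (Suc k) + 3/2 \<notin> \<int>\<^sub>\<le>\<^sub>0"
    using 1[of "L + real k + 3/2"] by (simp add: algebra_simps)
  ultimately show ?case using Suc unfolding admissible_def by blast
qed simp

text \<open>For \<eta> \<noteq> 0 the second claim is the first at an odd index. The numbers 2L+3+2n
  are the factors divided by in the contiguous relations and, for \<eta> = 0, in the even Taylor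
  coefficients.\<close>

lemma admissible_nz:
  assumes "admissible L \<eta>"
  shows "\<eta> \<noteq> 0 \<Longrightarrow> 2 * L + 2 + real n \<noteq> 0" "2 * L + 3 + 2 * real n \<noteq> 0"
proof -
  have 1: "x + real n \<noteq> 0" if "x \<notin> \<int>\<^sub>\<le>\<^sub>0" for x n
    using that by (metis add_eq_0_iff2 minus_of_nat_in_nonpos_Ints)
  show "2 * L + 2 + real n \<noteq> 0" if "\<eta> \<noteq> 0"
    using assms that 1 by (simp add: admissible_def)
  have "2 * L + 2 + real (2 * n + 1) \<noteq> 0" if "\<eta> \<noteq> 0"
    using assms that 1 by (simp only: admissible_def) blast
  moreover have "L + 3/2 + real n \<noteq> 0" if "\<eta> = 0"
    using assms that 1 by (simp add: admissible_def)
  ultimately show "2 * L + 3 + 2 * real n \<noteq> 0" by (cases "\<eta> = 0") auto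
qed

(* Taylor coefficients of the solution regular at the origin.  For \<eta> = 0 the odd coefficients
   vanish, and the convention x/0 = 0 makes the recursion meaningful for all admissible L. *)
fun coulomb_coeff :: "real \<Rightarrow> real \<Rightarrow> nat \<Rightarrow> real" where
  "coulomb_coeff L \<eta> 0 = 1"
| "coulomb_coeff L \<eta> (Suc 0) = \<eta> / (L + 1)"
| "coulomb_coeff L \<eta> (Suc (Suc n)) =
     (2 * \<eta> * coulomb_coeff L \<eta> (Suc n) - coulomb_coeff L \<eta> n)
       / ((real n + 2) * (real n + 3 + 2 * L))"

lemma coulomb_coeff_odd: "odd n \<Longrightarrow> coulomb_coeff L 0 n = 0"
  by (induction L "0::real" n rule: coulomb_coeff.induct) auto

lemma coulomb_coeff_1:
  assumes "admissible L \<eta>"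
  shows "(L + 1) * coulomb_coeff L \<eta> (Suc 0) = \<eta>"
  using admissible_nz(1)[OF assms, of 0] by (cases "\<eta> = 0") (auto simp: field_simps)

text \<open>Multiplied out, the recursion survives a vanishing denominator: this can only occur for
  \<eta> = 0 and odd n, where both sides are 0.\<close>

lemma coulomb_coeff_rec:
  assumes "admissible L \<eta>"
  shows "(real n + 2) * (real n + 3 + 2 * L) * coulomb_coeff L \<eta> (n + 2)
           = 2 * \<eta> * coulomb_coeff L \<eta> (n + 1) - coulomb_coeff L \<eta> n"
proof (cases "real n + 3 + 2 * L = 0")
  case True
  then have "2 * L + 2 + real (n + 1) = 0" by simp
  then have "\<eta> = 0" using admissible_nz(1)[OF assms, of "n + 1"] by blast
  moreover have "odd n"
  proof
    assume "even n"
    then obtain k where "n = 2 * k" by blast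
    then show False using True admissible_nz(2)[OF assms, of k] by auto
  qed
  ultimately show ?thesis by (simp add: coulomb_coeff_odd True)
next
  case False
  then have "(real n + 2) * (real n + 3 + 2 * L) \<noteq> 0" by simp
  then show ?thesis by simp
qed

declare coulomb_coeff.simps(2,3) [simp del]

lemma coulomb_coeff_unique:
  fixes B :: "nat \<Rightarrow> complex"
  assumes L: "admissible L \<eta>" "\<eta> \<noteq> 0"
    and "B 0 = 1" "of_real (L + 1) * B 1 = of_real \<eta>"
    and B: "\<And>n. of_real ((real n + 2) * (real n + 3 + 2 * L)) * B (n + 2) = of_real (2 * \<eta>) * B (n + 1) - B n"
  shows "B n = of_real (coulomb_coeff L \<eta> n)"
proof (induction n rule: less_induct)
  case (less n)
  consider "n = 0" | "n = 1" | m where "n = m + 2"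
    by (metis One_nat_def Suc_1 add.commute add_2_eq_Suc' not0_implies_Suc)
  then show ?case
  proof cases
    case 2
    have "L + 1 \<noteq> 0" using admissible_nz(1)[OF L, of 0] by simp
    then have "complex_of_real (L + 1) \<noteq> 0" by (simp del: of_real_add)
    then have "B 1 = of_real \<eta> / of_real (L + 1)"
      using assms(4) by (simp add: nonzero_eq_divide_eq mult.commute del: of_real_add)
    then show ?thesis using 2 by (simp add: coulomb_coeff.simps(2))
  next
    case 3
    have IH: "B m = of_real (coulomb_coeff L \<eta> m)" "B (m + 1) = of_real (coulomb_coeff L \<eta> (m + 1))"
      using less 3 by auto
    define r where "r = (real m + 2) * (real m + 3 + 2 * L)"
    have "of_real r * B n = of_real (2 * \<eta> * coulomb_coeff L \<eta> (m + 1) - coulomb_coeff L \<eta> m)"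
      using B[of m] unfolding 3 IH r_def by simp
    also have "\<dots> = of_real r * of_real (coulomb_coeff L \<eta> n)"
      unfolding coulomb_coeff_rec[OF L(1), of m, symmetric] by (simp add: 3 r_def)
    moreover have "r \<noteq> 0"
      using admissible_nz(1)[OF L, of "m + 1"] by (simp add: r_def)
    ultimately show ?thesis by simp
  qed (use assms in auto)
qed

text \<open>Coefficient form of the first-order relation that lowers L: (2L+1) phi_{L-1} = (2L+1 +
  (\<eta>/L) z) phi_L + z phi_L'. Both sides obey the same second-order recursion, whence the
  induction.\<close>

lemma coulomb_coeff_lower:
  assumes L: "admissible (L - 1) \<eta>" and L': "admissible L \<eta>"
  shows "(2 * L + 1) * coulomb_coeff (L - 1) \<eta> n =
    (2 * L + 1 + real n) * coulomb_coeff L \<eta> n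
      + (if n = 0 then 0 else \<eta> / L * coulomb_coeff L \<eta> (n - 1))"
proof (induction n rule: less_induct)
  case (less n)
  have nz: "2 * L + 1 \<noteq> 0" using admissible_nz(2)[OF L, of 0] by simp
  have nz1: "L \<noteq> 0" "L + 1 \<noteq> 0" if "\<eta> \<noteq> 0"
    using admissible_nz(1)[OF L that, of 0] admissible_nz(1)[OF L' that, of 0] by auto
  consider "n = 0" | "n = 1" | m where "n = m + 2"
    by (metis One_nat_def Suc_1 add.commute add_2_eq_Suc' not0_implies_Suc)
  then show ?case
  proof cases
    case 2
    have "(2 * L + 1) * coulomb_coeff (L - 1) \<eta> 1 = (2 * L + 2) * coulomb_coeff L \<eta> 1 + \<eta> / L"
    proof (cases "\<eta> = 0")
      case False
      then have "(2 * L + 2) * coulomb_coeff L \<eta> 1 = 2 * \<eta>"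
        using coulomb_coeff_1[OF L'] by simp algebra
      moreover have "(2 * L + 1) * (\<eta> / L) = 2 * \<eta> + \<eta> / L"
        using False nz1 by (simp add: field_simps)
      ultimately show ?thesis by (simp add: coulomb_coeff.simps(2))
    qed (simp add: coulomb_coeff.simps(2))
    then show ?thesis using 2 by (simp add: algebra_simps)
  next
    case 3
    let ?a = "coulomb_coeff L \<eta>" and ?b = "coulomb_coeff (L - 1) \<eta>"
    show ?thesis
    proof (cases "\<eta> = 0 \<and> odd n")
      case True
      then show ?thesis using 3 by (auto simp: coulomb_coeff_odd)
    next
      case False
      \<comment> \<open>This factor is cancelled at the end. It can vanish only for \<eta> = 0 and
        odd n, the case already set aside.\<close>
      have nz2: "real m + 1 + 2 * L \<noteq> 0"
      proof (cases "\<eta> = 0")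
        case True
        then obtain k where "m = 2 * k" using False 3 by auto
        then show ?thesis using admissible_nz(2)[OF L, of k] by auto
      next
        case False
        then show ?thesis using admissible_nz(1)[OF L, of "m + 1"] by auto
      qed
      have e1: "(real m + 2) * (real m + 1 + 2 * L) * ?b (m + 2) = 2 * \<eta> * ?b (m + 1) - ?b m"
        using coulomb_coeff_rec[OF L, of m] by (simp add: algebra_simps)
      have e2: "(real m + 2) * (real m + 3 + 2 * L) * ?a (m + 2) = 2 * \<eta> * ?a (m + 1) - ?a m"
        by (rule coulomb_coeff_rec[OF L'])
      have e3: "(real m + 1) * (real m + 2 + 2 * L) * ?a (m + 1)
                  = 2 * \<eta> * ?a m - (if m = 0 then 0 else ?a (m - 1))"
      proof (cases m)
        case 0
        then show ?thesis using coulomb_coeff_1[OF L'] by (simp add: algebra_simps)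
      next
        case (Suc j)
        then show ?thesis
          using coulomb_coeff_rec[OF L', of j] by (simp add: algebra_simps)
      qed
      have i1: "(2 * L + 1) * ?b (m + 1) = (2 * L + 2 + real m) * ?a (m + 1) + \<eta> / L * ?a m"
        using less[of "m + 1"] 3 by (simp add: algebra_simps)
      have i2: "(2 * L + 1) * ?b m = (2 * L + 1 + real m) * ?a m
                  + \<eta> / L * (if m = 0 then 0 else ?a (m - 1))"
        using less[of m] 3 by (auto simp: algebra_simps)
      \<comment> \<open>Writing \<eta> = q L removes the division; it remains true at L = 0, where
        admissibility forces \<eta> = 0.\<close>
      define q where "q = \<eta> / L"
      have q: "\<eta> = q * L" using nz1 by (auto simp: q_def)
      define u where "u = (if m = 0 then 0 else ?a (m - 1))"
      have "(real m + 2) * (real m + 1 + 2 * L) * ((2 * L + 1) * ?b (m + 2))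
              = 2 * \<eta> * ((2 * L + 1) * ?b (m + 1)) - (2 * L + 1) * ?b m"
        using e1 by algebra
      also have "\<dots> = 2 * \<eta> * ((2 * L + 2 + real m) * ?a (m + 1) + q * ?a m)
                       - ((2 * L + 1 + real m) * ?a m + q * u)"
        unfolding i1 i2 q_def u_def ..
      also have "\<dots> = (real m + 2) * (real m + 1 + 2 * L) *
                        ((2 * L + 3 + real m) * ?a (m + 2) + q * ?a (m + 1))"
      proof -
        have 1: "(real m + 2) * (real m + 1 + 2 * L) * ((2 * L + 3 + real m) * ?a (m + 2))
                = (real m + 1 + 2 * L) * (2 * \<eta> * ?a (m + 1) - ?a m)"
          unfolding e2[symmetric] by (simp add: mult_ac add_ac)
        have 2: "q * ((real m + 1) * (real m + 2 + 2 * L) * ?a (m + 1)) = q * (2 * \<eta> * ?a m - u)"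
          using e3 by (simp add: u_def)
        show ?thesis using 1 2 unfolding distrib_left q by (simp add: algebra_simps)
      qed
      finally have "(2 * L + 1) * ?b (m + 2) = (2 * L + 3 + real m) * ?a (m + 2) + q * ?a (m + 1)"
        using nz2 by simp
      then show ?thesis unfolding 3 q_def by (simp add: algebra_simps)
    qed
  qed auto
qed

text \<open>Coefficient form of the companion relation that raises L: phi_L' = \<eta>/(L+1) phi_L -
  d z phi_{L+1} with d = \<open>lower_d L \<eta>\<close>. Lowering from L+1 expresses two
  consecutive coefficients of phi_L through those of phi_{L+1}, and the recursion for L+1 eliminates
  the highest of these.\<close>

lemma coulomb_coeff_deriv:
  assumes L: "admissible L \<eta>"
  shows "real (n + 1) * coulomb_coeff L \<eta> (n + 1) = \<eta> / (L + 1) * coulomb_coeff L \<eta> n -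
     (1 + (\<eta> / (L + 1))\<^sup>2) / (2 * L + 3) * (if n = 0 then 0 else coulomb_coeff (L + 1) \<eta> (n - 1))"
proof -
  let ?a = "coulomb_coeff (L + 1) \<eta>"
  define e where "e = \<eta> / (L + 1)"
  have L1: "admissible (L + 1) \<eta>" using admissible_add[OF L, of 1] by simp
  have e: "\<eta> = e * (L + 1)"
    using admissible_nz(1)[OF L, of 0] by (cases "\<eta> = 0") (auto simp: e_def)
  have nz: "2 * L + 3 \<noteq> 0" using admissible_nz(2)[OF L, of 0] by simp
  define u where "u = (if n = 0 then 0 else ?a (n - 1))"
  have 1: "(2 * L + 3) * coulomb_coeff L \<eta> n = (2 * L + 3 + real n) * ?a n + e * u"
    using coulomb_coeff_lower[of "L + 1" \<eta> n] L L1
    by (auto simp: u_def e_def algebra_simps)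
  have 2: "(2 * L + 3) * coulomb_coeff L \<eta> (n + 1) = (2 * L + 4 + real n) * ?a (n + 1) + e * ?a n"
    using coulomb_coeff_lower[of "L + 1" \<eta> "n + 1"] L L1 by (simp add: e_def algebra_simps)
  have 3: "(real n + 1) * (real n + 4 + 2 * L) * ?a (n + 1) = 2 * \<eta> * ?a n - u"
  proof (cases n)
    case 0
    then show ?thesis using coulomb_coeff_1[OF L1] by (simp add: u_def algebra_simps)
  next
    case (Suc j)
    then show ?thesis
      using coulomb_coeff_rec[OF L1, of j] by (simp add: u_def algebra_simps)
  qed
  have "(2 * L + 3) * (real (n + 1) * coulomb_coeff L \<eta> (n + 1))
          = (2 * L + 3) * (e * coulomb_coeff L \<eta> n) - (1 + e\<^sup>2) * u"
    using 1 2 3 e by (simp) algebra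
  also have "\<dots> = (2 * L + 3) * (e * coulomb_coeff L \<eta> n - (1 + e\<^sup>2) / (2 * L + 3) * u)"
    using nz by (simp add: field_simps)
  finally show ?thesis using nz by (simp add: u_def e_def)
qed

text \<open>Factorial decay makes the series entire of exponential type, the growth on which the
  power sums of the reciprocal zeros depend.\<close>

lemma coulomb_coeff_bound:
  obtains M D :: real where "M > 0" "D > 0" "\<And>n. \<bar>coulomb_coeff L \<eta> n\<bar> \<le> M * D ^ n / fact n"
proof -
  \<comment> \<open>D satisfies 4 |\<eta>| D + 2 D = D^2, which closes the induction. From N on, the
    factor n + 1 + 2L of the denominator is at least n/2, and M absorbs the finitely many earlier
    coefficients.\<close>
  define D where "D = 4 * \<bar>\<eta>\<bar> + 2"
  define N where "N = nat \<lceil>4 * \<bar>L\<bar>\<rceil> + 2"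
  define M where "M = (\<Sum>n<N. \<bar>coulomb_coeff L \<eta> n\<bar> * fact n / D ^ n) + 1"
  have D: "D > 0" "D \<ge> 1" by (simp_all add: D_def)
  have s0: "(\<Sum>n<N. \<bar>coulomb_coeff L \<eta> n\<bar> * fact n / D ^ n) \<ge> 0"
    using D by (intro sum_nonneg) auto
  then have M: "M > 0" by (simp add: M_def)
  have "\<bar>coulomb_coeff L \<eta> n\<bar> \<le> M * D ^ n / fact n" for n
  proof (induction n rule: less_induct)
    case (less n)
    show ?case
    proof (cases "n < N")
      case True
      have "\<bar>coulomb_coeff L \<eta> n\<bar> * fact n / D ^ n \<le> (\<Sum>n<N. \<bar>coulomb_coeff L \<eta> n\<bar> * fact n / D ^ n)"
        using True D by (intro member_le_sum) auto
      then have "\<bar>coulomb_coeff L \<eta> n\<bar> * fact n / D ^ n \<le> M" by (simp add: M_def)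
      then show ?thesis using D by (simp add: field_simps)
    next
      case False
      then obtain m where m: "n = Suc (Suc m)" by (metis N_def add_2_eq_Suc' le_Suc_ex not_less add_Suc_right add.commute)
      have "real m \<ge> 4 * \<bar>L\<bar>" using False m by (simp add: N_def) linarith
      then have "real m \<ge> - 4 * L" by linarith
      then have den: "real m + 3 + 2 * L \<ge> (real m + 2) / 2" by (simp add: field_simps)
      have i1: "\<bar>coulomb_coeff L \<eta> (Suc m)\<bar> \<le> M * D ^ Suc m / fact (Suc m)" and
           i2: "\<bar>coulomb_coeff L \<eta> m\<bar> \<le> M * D ^ m / fact m"
        by (rule less.IH, simp add: m)+
      have "\<bar>coulomb_coeff L \<eta> n\<bar> = \<bar>2 * \<eta> * coulomb_coeff L \<eta> (Suc m) - coulomb_coeff L \<eta> m\<bar>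
              / ((real m + 2) * (real m + 3 + 2 * L))"
        using den by (simp add: m abs_mult coulomb_coeff.simps(3))
      also have "\<dots> \<le> \<bar>2 * \<eta> * coulomb_coeff L \<eta> (Suc m) - coulomb_coeff L \<eta> m\<bar>
              / ((real m + 2) * ((real m + 2) / 2))"
        using den by (intro divide_left_mono mult_left_mono mult_pos_pos) auto
      also have "\<dots> \<le> (2 * \<bar>\<eta>\<bar> * (M * D ^ Suc m / fact (Suc m)) + M * D ^ m / fact m)
              / ((real m + 2) * ((real m + 2) / 2))"
      proof (intro divide_right_mono)
        have "\<bar>2 * \<eta> * coulomb_coeff L \<eta> (Suc m) - coulomb_coeff L \<eta> m\<bar>
                \<le> 2 * \<bar>\<eta>\<bar> * \<bar>coulomb_coeff L \<eta> (Suc m)\<bar> + \<bar>coulomb_coeff L \<eta> m\<bar>"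
          using abs_triangle_ineq4[of "2 * \<eta> * coulomb_coeff L \<eta> (Suc m)" "coulomb_coeff L \<eta> m"]
          by (simp add: abs_mult)
        also have "\<dots> \<le> 2 * \<bar>\<eta>\<bar> * (M * D ^ Suc m / fact (Suc m)) + M * D ^ m / fact m"
          by (intro add_mono mult_left_mono i1 i2) auto
        finally show "\<bar>2 * \<eta> * coulomb_coeff L \<eta> (Suc m) - coulomb_coeff L \<eta> m\<bar> \<le> \<dots>" .
      qed auto
      also have "\<dots> = M * D ^ m / fact n * ((4 * \<bar>\<eta>\<bar> * D + 2 * (real m + 1)) / (real m + 2))"
        by (simp add: m divide_simps) (simp add: algebra_simps)
      also have "\<dots> \<le> M * D ^ m / fact n * D ^ 2"
      proof (intro mult_left_mono)
        have "4 * \<bar>\<eta>\<bar> * D + 2 * (real m + 1) \<le> (4 * \<bar>\<eta>\<bar> * D + 2 * 1) * (real m + 2)"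
          using D by (simp add: algebra_simps)
        also have "\<dots> \<le> (4 * \<bar>\<eta>\<bar> * D + 2 * D) * (real m + 2)"
          using D by (intro mult_right_mono add_left_mono mult_left_mono) auto
        also have "\<dots> = D ^ 2 * (real m + 2)"
          by (simp add: D_def algebra_simps power2_eq_square)
        finally show "(4 * \<bar>\<eta>\<bar> * D + 2 * (real m + 1)) / (real m + 2) \<le> D ^ 2"
          by (simp add: divide_le_eq)
      qed (use M D in auto)
      finally show ?thesis by (simp add: m power2_eq_square mult_ac)
    qed
  qed
  then show ?thesis using that[of M D] M D by blast
qed

text \<open>Eliminating the derivative from the lowering and raising relations gives phi_{L-1} = (1
  + b z) phi_L - c z^2 phi_{L+1}. Here b and c are the values of \<open>lower_b\<close> and
  \<open>lower_c\<close>, while \<open>lower_d\<close> is the coefficient in the derivative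
  relation.\<close>

definition lower_b :: "real \<Rightarrow> real \<Rightarrow> real" where
  "lower_b L \<eta> = (\<eta> / L + \<eta> / (L + 1)) / (2 * L + 1)"

definition lower_d :: "real \<Rightarrow> real \<Rightarrow> real" where
  "lower_d L \<eta> = (1 + (\<eta> / (L + 1))\<^sup>2) / (2 * L + 3)"

definition lower_c :: "real \<Rightarrow> real \<Rightarrow> real" where
  "lower_c L \<eta> = lower_d L \<eta> / (2 * L + 1)"

definition coulomb_fps :: "real \<Rightarrow> real \<Rightarrow> complex fps" where
  "coulomb_fps L \<eta> = Abs_fps (\<lambda>n. of_real (coulomb_coeff L \<eta> n))"

lemma coulomb_fps_nth [simp]: "fps_nth (coulomb_fps L \<eta>) n = of_real (coulomb_coeff L \<eta> n)"
  by (simp add: coulomb_fps_def)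

lemma coulomb_fps_deriv:
  assumes "admissible L \<eta>"
  shows "fps_deriv (coulomb_fps L \<eta>) = fps_const (of_real (\<eta> / (L + 1))) * coulomb_fps L \<eta>
           - fps_const (of_real (lower_d L \<eta>)) * fps_X * coulomb_fps (L + 1) \<eta>"
proof (rule fps_ext)
  fix n
  have "of_nat (n + 1) * complex_of_real (coulomb_coeff L \<eta> (n + 1)) =
          of_real (real (n + 1) * coulomb_coeff L \<eta> (n + 1))" by simp
  also note coulomb_coeff_deriv[OF assms, of n]
  finally show "fps_deriv (coulomb_fps L \<eta>) $ n =
     (fps_const (of_real (\<eta> / (L + 1))) * coulomb_fps L \<eta>
           - fps_const (of_real (lower_d L \<eta>)) * fps_X * coulomb_fps (L + 1) \<eta>) $ n"
    by (auto simp: mult.assoc lower_d_def simp del: of_nat_Suc)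
qed

lemma coulomb_fps_lower:
  assumes "admissible (L - 1) \<eta>" "admissible L \<eta>"
  shows "coulomb_fps (L - 1) \<eta> = (1 + fps_const (of_real (lower_b L \<eta>)) * fps_X) * coulomb_fps L \<eta>
           - fps_const (of_real (lower_c L \<eta>)) * fps_X ^ 2 * coulomb_fps (L + 1) \<eta>"
proof (rule fps_ext)
  fix n
  let ?a = "coulomb_coeff L \<eta>" and ?a' = "coulomb_coeff (L + 1) \<eta>"
  have nz: "2 * L + 1 \<noteq> 0" using admissible_nz(2)[OF assms(1), of 0] by simp
  have "(2 * L + 1) * coulomb_coeff (L - 1) \<eta> n = (2 * L + 1 + real n) * ?a n
      + (if n = 0 then 0 else \<eta> / L * ?a (n - 1))"
    by (rule coulomb_coeff_lower[OF assms])
  also have "\<dots> = (2 * L + 1) * (?a n + lower_b L \<eta> * (if n = 0 then 0 else ?a (n - 1))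
        - lower_c L \<eta> * (if n < 2 then 0 else ?a' (n - 2)))"
  proof (cases n)
    case (Suc m)
    define u where "u = (if m = 0 then 0 else ?a' (m - 1))"
    have u: "(if n < 2 then 0 else ?a' (n - 2)) = u"
      by (auto simp: Suc numeral_2_eq_2 u_def)
    have 1: "real n * ?a n = \<eta> / (L + 1) * ?a m - lower_d L \<eta> * u"
      using coulomb_coeff_deriv[OF assms(2), of m] by (simp add: Suc lower_d_def u_def)
    have 2: "(2 * L + 1) * lower_b L \<eta> = \<eta> / L + \<eta> / (L + 1)"
      using nz by (simp add: lower_b_def)
    have 3: "(2 * L + 1) * lower_c L \<eta> = lower_d L \<eta>"
      using nz by (simp add: lower_c_def)
    have "(2 * L + 1) * (?a n + lower_b L \<eta> * ?a m - lower_c L \<eta> * u) =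
       (2 * L + 1) * ?a n + ((2 * L + 1) * lower_b L \<eta>) * ?a m - ((2 * L + 1) * lower_c L \<eta>) * u"
      by (simp add: algebra_simps)
    also have "\<dots> = (2 * L + 1) * ?a n + \<eta> / L * ?a m + real n * ?a n"
      unfolding 1 2 3 by (simp add: distrib_right)
    finally show ?thesis unfolding u by (simp add: Suc distrib_right)
  qed auto
  finally have "coulomb_coeff (L - 1) \<eta> n = ?a n + lower_b L \<eta> * (if n = 0 then 0 else ?a (n - 1))
        - lower_c L \<eta> * (if n < 2 then 0 else ?a' (n - 2))"
    using nz by (simp only: mult_cancel_left) simp
  then show "coulomb_fps (L - 1) \<eta> $ n =
      ((1 + fps_const (of_real (lower_b L \<eta>)) * fps_X) * coulomb_fps L \<eta>
           - fps_const (of_real (lower_c L \<eta>)) * fps_X ^ 2 * coulomb_fps (L + 1) \<eta>) $ n"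
    by (auto simp: distrib_right mult.assoc fps_X_power_mult_nth)
qed

lemma coulomb_fps_conv_radius [simp]: "fps_conv_radius (coulomb_fps L \<eta>) = \<infinity>"
  unfolding fps_conv_radius_def
proof (rule conv_radius_inftyI'')
  fix z :: complex
  obtain M D where MD: "M > 0" "D > 0" "\<And>n. \<bar>coulomb_coeff L \<eta> n\<bar> \<le> M * D ^ n / fact n"
    by (metis coulomb_coeff_bound)
  show "summable (\<lambda>n. fps_nth (coulomb_fps L \<eta>) n * z ^ n)"
  proof (rule summable_comparison_test)
    have "norm (fps_nth (coulomb_fps L \<eta>) n * z ^ n) \<le> M * ((D * norm z) ^ n /\<^sub>R fact n)" for n
      using mult_right_mono[OF MD(3)[of n], of "norm z ^ n"]
      by (simp add: norm_mult norm_power power_mult_distrib field_simps)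
    then show "\<exists>N. \<forall>n\<ge>N. norm (fps_nth (coulomb_fps L \<eta>) n * z ^ n) \<le> M * ((D * norm z) ^ n /\<^sub>R fact n)"
      by blast
    show "summable (\<lambda>n. M * ((D * norm z) ^ n /\<^sub>R fact n))"
      by (intro summable_mult summable_exp_generic)
  qed
qed

section \<open>The entire function: symmetry, growth, contiguous relations\<close>

definition phi :: "real \<Rightarrow> real \<Rightarrow> complex \<Rightarrow> complex" where
  "phi L \<eta> = eval_fps (coulomb_fps L \<eta>)"

lemma phi_0 [simp]: "phi L \<eta> 0 = 1"
  by (simp add: phi_def eval_fps_at_0)

lemma phi_sums: "(\<lambda>n. of_real (coulomb_coeff L \<eta> n) * z ^ n) sums phi L \<eta> z"
  using sums_eval_fps[of z "coulomb_fps L \<eta>"] by (simp add: phi_def)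

lemma phi_cnj: "phi L \<eta> (cnj z) = cnj (phi L \<eta> z)"
proof -
  have "(\<lambda>n. cnj (of_real (coulomb_coeff L \<eta> n) * z ^ n)) sums cnj (phi L \<eta> z)"
    using phi_sums by (simp only: sums_cnj)
  then show ?thesis using phi_sums[of L \<eta> "cnj z"] by (simp add: sums_unique2)
qed

lemma phi_holomorphic [holomorphic_intros]: "phi L \<eta> holomorphic_on A"
  unfolding phi_def by (intro holomorphic_on_eval_fps) auto

lemma phi_has_fps_expansion: "phi L \<eta> has_fps_expansion coulomb_fps L \<eta>"
  unfolding has_fps_expansion_def phi_def by simp

lemma phi_growth:
  obtains M D :: real where "M > 0" "D > 0" "\<And>z. norm (phi L \<eta> z) \<le> M * exp (D * norm z)"
proof -
  obtain M D where MD: "M > 0" "D > 0" "\<And>n. \<bar>coulomb_coeff L \<eta> n\<bar> \<le> M * D ^ n / fact n"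
    by (metis coulomb_coeff_bound)
  have "norm (phi L \<eta> z) \<le> M * exp (D * norm z)" for z
  proof (rule norm_sums_le[OF phi_sums])
    show "(\<lambda>n. M * ((D * norm z) ^ n /\<^sub>R fact n)) sums (M * exp (D * norm z))"
      by (intro sums_mult exp_converges)
    show "norm (of_real (coulomb_coeff L \<eta> n) * z ^ n) \<le> M * ((D * norm z) ^ n /\<^sub>R fact n)" for n
      using mult_right_mono[OF MD(3)[of n], of "norm z ^ n"]
      by (simp add: norm_mult norm_power power_mult_distrib field_simps)
  qed
  then show ?thesis using that MD by blast
qed

lemma entire_fps_mult: "fps_conv_radius f = \<infinity> \<Longrightarrow> fps_conv_radius g = \<infinity> \<Longrightarrow> fps_conv_radius (f * g) = \<infinity>"
  for f g :: "complex fps"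
  using fps_conv_radius_mult[of f g] by simp

lemma entire_fps_add: "fps_conv_radius f = \<infinity> \<Longrightarrow> fps_conv_radius g = \<infinity> \<Longrightarrow> fps_conv_radius (f + g) = \<infinity>"
  for f g :: "complex fps"
  using fps_conv_radius_add[of f g] by simp

lemma deriv_phi:
  assumes "admissible L \<eta>"
  shows "deriv (phi L \<eta>) z = of_real (\<eta> / (L + 1)) * phi L \<eta> z
           - of_real (lower_d L \<eta>) * z * phi (L + 1) \<eta> z"
  unfolding phi_def
  by (subst eval_fps_deriv [symmetric])
     (simp_all add: coulomb_fps_deriv[OF assms] eval_fps_diff eval_fps_mult entire_fps_mult del: of_real_divide)

lemma phi_lower:
  assumes "admissible (L - 1) \<eta>" "admissible L \<eta>"
  shows "phi (L - 1) \<eta> z = (1 + of_real (lower_b L \<eta>) * z) * phi L \<eta> z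
           - of_real (lower_c L \<eta>) * z ^ 2 * phi (L + 1) \<eta> z"
  unfolding phi_def
  by (simp add: coulomb_fps_lower[OF assms] eval_fps_diff eval_fps_add eval_fps_mult entire_fps_mult entire_fps_add)

text \<open>For large L the denominators absorb the numerators together with two factors \<epsilon>.
  The resulting geometric bound is uniform in L beyond the threshold.\<close>

lemma coulomb_coeff_small:
  assumes "0 < \<epsilon>" "\<epsilon> \<le> 1" "2 * L + 2 \<ge> (2 * \<bar>\<eta>\<bar> + 1) / \<epsilon>\<^sup>2"
  shows "\<bar>coulomb_coeff L \<eta> n\<bar> \<le> \<epsilon> ^ n"
proof (induction n rule: less_induct)
  case (less n)
  have "(2 * \<bar>\<eta>\<bar> + 1) / \<epsilon>\<^sup>2 > 0" using assms by (intro divide_pos_pos) auto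
  then have pos: "2 * L + 2 > 0" using assms by linarith
  have b: "2 * \<bar>\<eta>\<bar> + 1 \<le> (2 * L + 2) * \<epsilon>\<^sup>2"
    using assms by (simp add: field_simps)
  consider "n = 0" | "n = 1" | m where "n = Suc (Suc m)"
    by (metis One_nat_def not0_implies_Suc)
  then show ?case
  proof cases
    case 2
    have "\<epsilon>\<^sup>2 \<le> \<epsilon>" using assms by (simp add: power2_eq_square mult_left_le)
    then have "(2 * L + 2) * \<epsilon>\<^sup>2 \<le> (2 * L + 2) * \<epsilon>" using pos by (intro mult_left_mono) auto
    with b have "\<bar>\<eta>\<bar> \<le> \<epsilon> * (L + 1)" by (simp add: algebra_simps)
    then show ?thesis using 2 pos by (simp add: coulomb_coeff.simps(2) field_simps)
  next
    case 3
    have i: "\<bar>coulomb_coeff L \<eta> (Suc m)\<bar> \<le> \<epsilon> ^ Suc m" "\<bar>coulomb_coeff L \<eta> m\<bar> \<le> \<epsilon> ^ m"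
      by (rule less.IH, simp add: 3)+
    have "\<bar>2 * \<eta> * coulomb_coeff L \<eta> (Suc m) - coulomb_coeff L \<eta> m\<bar>
            \<le> 2 * \<bar>\<eta>\<bar> * \<bar>coulomb_coeff L \<eta> (Suc m)\<bar> + \<bar>coulomb_coeff L \<eta> m\<bar>"
      using abs_triangle_ineq4[of "2 * \<eta> * coulomb_coeff L \<eta> (Suc m)" "coulomb_coeff L \<eta> m"]
      by (simp add: abs_mult)
    also have "\<dots> \<le> 2 * \<bar>\<eta>\<bar> * \<epsilon> ^ m + \<epsilon> ^ m"
    proof (intro add_mono mult_left_mono)
      show "\<bar>coulomb_coeff L \<eta> (Suc m)\<bar> \<le> \<epsilon> ^ m"
        using i(1) assms power_decreasing[of m "Suc m" \<epsilon>] by (simp del: power_Suc)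
    qed (use i in auto)
    also have "\<dots> = (2 * \<bar>\<eta>\<bar> + 1) * \<epsilon> ^ m" by (simp add: algebra_simps)
    also have "\<dots> \<le> (2 * L + 2) * \<epsilon>\<^sup>2 * \<epsilon> ^ m"
      using b assms by (intro mult_right_mono) auto
    also have "\<dots> \<le> ((real m + 2) * (real m + 3 + 2 * L)) * \<epsilon>\<^sup>2 * \<epsilon> ^ m"
    proof (intro mult_right_mono)
      have "1 * (2 * L + 2) \<le> (real m + 2) * (real m + 3 + 2 * L)"
        using pos by (intro mult_mono) auto
      then show "2 * L + 2 \<le> (real m + 2) * (real m + 3 + 2 * L)" by simp
    qed (use assms in auto)
    finally have "\<bar>2 * \<eta> * coulomb_coeff L \<eta> (Suc m) - coulomb_coeff L \<eta> m\<bar>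
                    \<le> ((real m + 2) * (real m + 3 + 2 * L)) * \<epsilon> ^ n"
      by (simp add: 3 power2_eq_square mult_ac)
    moreover have "(real m + 2) * (real m + 3 + 2 * L) > 0"
      using pos by (intro mult_pos_pos) auto
    ultimately show ?thesis
      by (simp add: 3 coulomb_coeff.simps(3) abs_mult field_simps)
  qed simp
qed

text \<open>Used in two ways: it bounds the entries of the eigenvectors by a multiple of |z|^k, and
  it shows that these vectors are not zero.\<close>

lemma phi_tendsto_1: "(\<lambda>k. phi (L + real k) \<eta> z) \<longlonglongrightarrow> 1"
proof (rule tendstoI)
  fix e :: real assume e: "e > 0"
  \<comment> \<open>With x = \<epsilon> |z| below 1/2 and e/2, the tail x / (1 - x) of the geometric
    series is at most 2 x < e.\<close>
  define \<epsilon> where "\<epsilon> = (min 1 e / 2) / (norm z + 1)"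
  have nz: "norm z + 1 > 0" using norm_ge_zero[of z] by linarith
  have "\<epsilon> > 0" using e nz by (simp add: \<epsilon>_def)
  have ez: "\<epsilon> * (norm z + 1) = min 1 e / 2" using nz by (metis \<epsilon>_def less_irrefl nonzero_eq_divide_eq)
  have "\<epsilon> * norm z < \<epsilon> * (norm z + 1)" using \<open>\<epsilon> > 0\<close> by simp
  then have ez1: "\<epsilon> * norm z < min 1 e / 2" using ez by simp
  have "\<epsilon> * 1 \<le> \<epsilon> * (norm z + 1)" using \<open>\<epsilon> > 0\<close> by (intro mult_left_mono) auto
  then have "\<epsilon> \<le> 1" unfolding ez by simp
  have "eventually (\<lambda>k. 2 * (L + real k) + 2 \<ge> (2 * \<bar>\<eta>\<bar> + 1) / \<epsilon>\<^sup>2) sequentially"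
    by real_asymp
  then show "eventually (\<lambda>k. dist (phi (L + real k) \<eta> z) 1 < e) sequentially"
  proof eventually_elim
    case (elim k)
    let ?a = "coulomb_coeff (L + real k) \<eta>" and ?x = "\<epsilon> * norm z"
    have x: "0 \<le> ?x" "?x < 1/2" using ez1 \<open>\<epsilon> > 0\<close> by auto
    have "(\<lambda>n. of_real (?a (n + 1)) * z ^ (n + 1)) sums (phi (L + real k) \<eta> z - 1)"
      using sums_split_initial_segment[OF phi_sums[of "L + real k" \<eta> z], of 1] by simp
    moreover have "(\<lambda>n. ?x * ?x ^ n) sums (?x * (1 / (1 - ?x)))"
      using x by (intro sums_mult geometric_sums) auto
    moreover have "norm (of_real (?a (n + 1)) * z ^ (n + 1)) \<le> ?x * ?x ^ n" for n
      using mult_right_mono[OF coulomb_coeff_small[OF \<open>\<epsilon> > 0\<close> \<open>\<epsilon> \<le> 1\<close> elim, of "n + 1"], of "norm z ^ (n + 1)"]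
      by (simp add: norm_mult norm_power power_mult_distrib mult_ac)
    ultimately have "norm (phi (L + real k) \<eta> z - 1) \<le> ?x * (1 / (1 - ?x))"
      by (rule norm_sums_le)
    also have "\<dots> \<le> ?x * 2"
      using x by (intro mult_left_mono) (auto simp: divide_le_eq)
    also have "\<dots> < e" using ez1 by linarith
    finally show ?case by (simp add: dist_norm)
  qed
qed

section \<open>Agreement with the Bessel and Kummer series\<close>

lemma coulomb_coeff_even:
  assumes "L + 3/2 \<notin> \<int>\<^sub>\<le>\<^sub>0"
  shows "coulomb_coeff L 0 (2 * m) =
    Gamma (L + 3/2) * ((-1) ^ m / fact m * rGamma (L + 1/2 + real m + 1) * (1/2) ^ (2 * m))"
proof (induction m)
  case 0
  have "Gamma (L + 3/2) * rGamma (L + 3/2) = 1"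
    using assms by (simp add: Gamma_def rGamma_eq_zero_iff)
  then show ?case by (simp add: add.assoc)
next
  case (Suc m)
  have adm: "admissible L 0" using assms by (simp add: admissible_def)
  define x where "x = L + 3/2 + real m"
  have x: "x \<noteq> 0" using admissible_nz(2)[OF adm, of m] by (simp add: x_def)
  have r: "rGamma (L + 1/2 + real m + 1) = x * rGamma (x + 1)"
    using rGamma_plus1[of x] by (simp add: x_def add_ac)
  have "(2 * real m + 2) * (2 * x) * coulomb_coeff L 0 (2 * Suc m) = - coulomb_coeff L 0 (2 * m)"
    using coulomb_coeff_rec[OF adm, of "2 * m"] by (simp add: x_def algebra_simps)
  also have "\<dots> = - (Gamma (L + 3/2) * ((-1) ^ m / fact m * (x * rGamma (x + 1)) * (1/2) ^ (2 * m)))"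
    unfolding Suc r ..
  also have "\<dots> = (2 * real m + 2) * (2 * x) *
     (Gamma (L + 3/2) * ((-1) ^ Suc m / fact (Suc m) * rGamma (x + 1) * (1/2) ^ (2 * Suc m)))"
  proof -
    have 1: "(2 * real m + 2) * ((-1) ^ Suc m / fact (Suc m)) = - 2 * ((-1) ^ m / fact m)"
      by (simp add: divide_simps)
    have 2: "(1/2 :: real) ^ (2 * Suc m) = (1/4) * (1/2) ^ (2 * m)"
      by (simp add: power2_eq_square)
    have "(2 * real m + 2) * (2 * x) *
      (Gamma (L + 3/2) * ((-1) ^ Suc m / fact (Suc m) * rGamma (x + 1) * (1/2) ^ (2 * Suc m))) =
      ((2 * real m + 2) * ((-1) ^ Suc m / fact (Suc m))) * (2 * x) *
      (Gamma (L + 3/2) * (rGamma (x + 1) * (1/2) ^ (2 * Suc m)))" by (simp only: mult_ac)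
    then show ?thesis unfolding 1 2 by (simp only: mult_ac)
  qed
  finally have "coulomb_coeff L 0 (2 * Suc m) =
     Gamma (L + 3/2) * ((-1) ^ Suc m / fact (Suc m) * rGamma (x + 1) * (1/2) ^ (2 * Suc m))"
    by (rule mult_left_cancel[THEN iffD1, rotated]) (use x in auto)
  then show ?case by (simp add: x_def add_ac)
qed

lemma coulomb_phi_eq_phi_eta_0:
  assumes "L + 3/2 \<notin> \<int>\<^sub>\<le>\<^sub>0"
  shows "coulomb_phi L 0 z = phi L 0 z"
proof -
  let ?f = "\<lambda>m. (-1) ^ m / fact m * rGamma (of_real (L + 1/2) + of_nat m + 1) * (z / 2) ^ (2 * m)"
  have term_eq: "complex_of_real (Gamma (L + 3/2)) * ?f m = of_real (coulomb_coeff L 0 (2 * m)) * z ^ (2 * m)" for m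
  proof -
    have "rGamma (of_real (L + 1/2) + of_nat m + 1 :: complex) = of_real (rGamma (L + 1/2 + real m + 1))"
      by (simp flip: rGamma_complex_of_real)
    then show ?thesis
      by (simp add: coulomb_coeff_even[OF assms] power_divide power_mult_distrib)
  qed
  have "(\<lambda>m. of_real (coulomb_coeff L 0 (2 * m)) * z ^ (2 * m)) sums phi L 0 z"
  proof (subst sums_mono_reindex[of "\<lambda>m. 2 * m" "\<lambda>n. of_real (coulomb_coeff L 0 n) * z ^ n"])
    show "strict_mono (\<lambda>m::nat. 2 * m)" by (simp add: strict_mono_def)
    show "of_real (coulomb_coeff L 0 n) * z ^ n = 0" if "n \<notin> range (\<lambda>m. 2 * m)" for n
    proof -
      have "odd n" using that by (auto elim: evenE)
      then show ?thesis by (simp add: coulomb_coeff_odd)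
    qed
  qed (rule phi_sums)
  then have s: "(\<lambda>m. of_real (Gamma (L + 3/2)) * ?f m) sums phi L 0 z"
    by (simp only: term_eq)
  have "Gamma (L + 3/2) \<noteq> 0" using assms by (simp add: Gamma_eq_zero_iff)
  then have "summable ?f"
    using sums_summable[OF s] by (subst (asm) summable_cmult_iff) simp
  then have "of_real (Gamma (L + 3/2)) * (\<Sum>m. ?f m) = (\<Sum>m. of_real (Gamma (L + 3/2)) * ?f m)"
    by (rule suminf_mult [symmetric])
  also have "\<dots> = phi L 0 z" using s by (simp only: sums_iff)
  finally show ?thesis by (simp only: coulomb_phi_eta_0[OF assms])
qed

text \<open>Formal power series suffice: K solves Kummer's equation, and the factor E turns it into
  X G'' + b G' = (2\<eta> - X) G. The complex parameters combine to 2ia - ib = 2\<eta>, so the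
  coefficients of G obey the real recursion of \<open>coulomb_coeff\<close>.\<close>

lemma coulomb_phi_eq_phi_eta_nonzero:
  assumes L: "admissible L \<eta>" "\<eta> \<noteq> 0"
  shows "coulomb_phi L \<eta> z = phi L \<eta> z"
proof -
  define a where "a = of_real (L + 1) - \<i> * of_real \<eta>"
  define b :: complex where "b = of_real (2 * L + 2)"
  define K where "K = Abs_fps (\<lambda>n. pochhammer a n / pochhammer b n * ((2 * \<i>) ^ n / fact n))"
  define E where "E = fps_exp (- \<i>)"
  define G where "G = E * K"
  have b: "b + of_nat n \<noteq> 0" for n
  proof -
    have "b + of_nat n = of_real (2 * L + 2 + real n)" by (simp add: b_def)
    then show ?thesis using admissible_nz(1)[OF L, of n] by (simp only: of_real_eq_0_iff) simp
  qed
  have pb: "pochhammer b n \<noteq> 0" for n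
    using b unfolding pochhammer_eq_0_iff by (metis add.left_inverse)
  have Krec: "of_nat (n + 1) * (b + of_nat n) * K $ (n + 1) = 2 * \<i> * (a + of_nat n) * K $ n" for n
  proof -
    define N :: complex where "N = of_nat (n + 1)"
    define u where "u = a + of_nat n"
    define v where "v = b + of_nat n"
    have "N \<noteq> 0" unfolding N_def using of_nat_neq_0 by simp
    have K1: "K $ (n + 1) = pochhammer a n * u / (pochhammer b n * v) * ((2 * \<i>) ^ n * (2 * \<i>) / (N * fact n))"
      by (simp add: K_def pochhammer_Suc u_def v_def N_def)
    have Kn: "K $ n = pochhammer a n / pochhammer b n * ((2 * \<i>) ^ n / fact n)"
      by (simp add: K_def)
    show ?thesis
      using pb[of n] b[of n] \<open>N \<noteq> 0\<close> unfolding K1 Kn N_def[symmetric] u_def[symmetric] v_def[symmetric]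
      by (simp add: divide_simps)
  qed
  have KODE: "fps_X * fps_deriv (fps_deriv K) + fps_const b * fps_deriv K =
     fps_const (2 * \<i>) * (fps_X * fps_deriv K + fps_const a * K)"
  proof (rule fps_ext)
    fix n
    show "(fps_X * fps_deriv (fps_deriv K) + fps_const b * fps_deriv K) $ n =
     (fps_const (2 * \<i>) * (fps_X * fps_deriv K + fps_const a * K)) $ n"
      using Krec[of n] by (cases n) (simp_all add: algebra_simps)
  qed
  have dE: "fps_deriv E = fps_const (- \<i>) * E"
    by (simp add: E_def)
  have ii: "fps_const \<i> * fps_const \<i> = (-1 :: complex fps)" by (simp flip: fps_const_neg)
  have G1: "E * fps_deriv K = fps_deriv G + fps_const \<i> * G"
    by (simp add: G_def dE algebra_simps flip: fps_const_neg)
  have G2: "E * fps_deriv (fps_deriv K) = fps_deriv (fps_deriv G) + 2 * fps_const \<i> * fps_deriv G - G"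
  proof -
    have "fps_deriv (E * fps_deriv K) = fps_const (- \<i>) * E * fps_deriv K + E * fps_deriv (fps_deriv K)"
      by (simp add: dE algebra_simps)
    then have "E * fps_deriv (fps_deriv K) = fps_deriv (E * fps_deriv K) + fps_const \<i> * (E * fps_deriv K)"
      by (simp add: algebra_simps flip: fps_const_neg)
    also have "\<dots> = fps_deriv (fps_deriv G) + 2 * fps_const \<i> * fps_deriv G + (fps_const \<i> * fps_const \<i>) * G"
      unfolding G1 by (simp add: algebra_simps)
    finally show ?thesis unfolding ii by simp
  qed
  have "fps_X * (E * fps_deriv (fps_deriv K)) + fps_const b * (E * fps_deriv K) =
     fps_const (2 * \<i>) * (fps_X * (E * fps_deriv K) + fps_const a * (E * K))"
    using arg_cong[OF KODE, of "\<lambda>F. E * F"] by (simp add: algebra_simps)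
  then have "fps_X * fps_deriv (fps_deriv G) + fps_const b * fps_deriv G
      = fps_const (2 * \<i> * a - \<i> * b) * G + (2 * (fps_const \<i> * fps_const \<i>) + 1) * fps_X * G"
    unfolding G1 G2 unfolding G_def[symmetric]
    by (simp add: algebra_simps flip: fps_const_mult fps_const_sub numeral_fps_const)
  also have "2 * \<i> * a - \<i> * b = of_real (2 * \<eta>)"
    by (simp add: a_def b_def algebra_simps)
  finally have GODE: "fps_X * fps_deriv (fps_deriv G) + fps_const b * fps_deriv G
      = fps_const (of_real (2 * \<eta>)) * G - fps_X * G"
    unfolding ii by simp
  have G_coeff: "G $ n = of_real (coulomb_coeff L \<eta> n)" for n
  proof (rule coulomb_coeff_unique[OF L])
    show "G $ 0 = 1" by (simp add: G_def E_def K_def)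
    have "b * G $ 1 = of_real (2 * \<eta>)"
      using arg_cong[OF GODE, of "\<lambda>F. fps_nth F 0"] \<open>G $ 0 = 1\<close> by simp
    then have "2 * (of_real (L + 1) * G $ 1) = 2 * of_real \<eta>"
      by (simp add: b_def algebra_simps)
    then show "of_real (L + 1) * G $ 1 = of_real \<eta>"
      by (simp only: mult_left_cancel[OF zero_neq_numeral[symmetric]])
    show "of_real ((real n + 2) * (real n + 3 + 2 * L)) * G $ (n + 2) =
            of_real (2 * \<eta>) * G $ (n + 1) - G $ n" for n
      using arg_cong[OF GODE, of "\<lambda>F. fps_nth F (n + 1)"]
      by (simp add: b_def algebra_simps)
  qed
  then have GF: "G = coulomb_fps L \<eta>" by (intro fps_ext) simp
  \<comment> \<open>Convergence of K is read off from that of the Coulomb series rather than from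
    the Pochhammer quotients.\<close>
  have "K = fps_exp \<i> * coulomb_fps L \<eta>"
  proof -
    have "fps_exp \<i> * E = 1" by (simp add: E_def flip: fps_exp_add_mult)
    then show ?thesis by (simp add: G_def mult.assoc[symmetric] flip: GF)
  qed
  then have Kr: "fps_conv_radius K = \<infinity>" by (simp add: entire_fps_mult)
  have "exp (- \<i> * z) * kummer_1F1 a b (2 * \<i> * z) = eval_fps E z * eval_fps K z"
    by (simp add: E_def K_def kummer_1F1_def eval_fps_def[of "Abs_fps _"] power_mult_distrib mult_ac)
  also have "\<dots> = eval_fps G z"
    unfolding G_def by (rule eval_fps_mult [symmetric]) (simp_all add: E_def Kr)
  finally show ?thesis using L by (simp add: coulomb_phi_def phi_def GF a_def b_def)
qed

lemma coulomb_phi_eq_phi: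
  assumes "admissible L \<eta>"
  shows "coulomb_phi L \<eta> z = phi L \<eta> z"
  using assms coulomb_phi_eq_phi_eta_0 coulomb_phi_eq_phi_eta_nonzero[OF assms]
  by (cases "\<eta> = 0") (auto simp: admissible_def)

lemma coulomb_F_zero_iff:
  assumes "admissible L \<eta>" "z \<noteq> 0"
  shows "coulomb_F L \<eta> z = 0 \<longleftrightarrow> phi L \<eta> z = 0"
  using coulomb_F_eq_0_iff[of \<eta> L z] assms coulomb_phi_eq_phi[OF assms(1)]
  by (simp add: admissible_def)

section \<open>Tridiagonal operators and Hankel forms\<close>

text \<open>Gaussian elimination, by solving one equation for one unknown. Over the complex numbers
  it yields a combination of eigenvectors that vanishes where the weights have the wrong sign, over
  the reals a polynomial with real values at the zeros.\<close>

lemma homogeneous_system_nontrivial: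
  fixes \<alpha> :: "'a \<Rightarrow> 'i \<Rightarrow> 'f :: field"
  assumes "finite A" "finite I" "card A < card I"
  shows "\<exists>x. (\<exists>i\<in>I. x i \<noteq> 0) \<and> (\<forall>a\<in>A. (\<Sum>i\<in>I. \<alpha> a i * x i) = 0)"
  using assms
proof (induction A arbitrary: I \<alpha> rule: finite_induct)
  case empty
  then show ?case by (intro exI[of _ "\<lambda>_. 1"]) (auto simp: card_gt_0_iff)
next
  case (insert a A)
  show ?case
  proof (cases "\<forall>i\<in>I. \<alpha> a i = 0")
    case True
    have "card A < card I" using insert by simp
    then show ?thesis using insert.IH[OF insert.prems(1), of \<alpha>] True by auto
  next
    case False
    then obtain i0 where i0: "i0 \<in> I" "\<alpha> a i0 \<noteq> 0" by blast
    define \<beta> where "\<beta> = (\<lambda>b i. \<alpha> b i - \<alpha> b i0 * \<alpha> a i / \<alpha> a i0)"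
    have "card A < card (I - {i0})" using insert i0 by simp
    then obtain x where x: "\<exists>i\<in>I - {i0}. x i \<noteq> 0" "\<forall>b\<in>A. (\<Sum>i\<in>I - {i0}. \<beta> b i * x i) = 0"
      using insert.IH[of "I - {i0}" \<beta>] insert.prems by auto
    define S where "S = (\<Sum>i\<in>I - {i0}. \<alpha> a i * x i)"
    define x' where "x' = x(i0 := - S / \<alpha> a i0)"
    have split: "(\<Sum>i\<in>I. \<alpha> b i * x' i) = (\<Sum>i\<in>I - {i0}. \<alpha> b i * x i) - \<alpha> b i0 * S / \<alpha> a i0" for b
    proof -
      have "(\<Sum>i\<in>I. \<alpha> b i * x' i) = \<alpha> b i0 * x' i0 + (\<Sum>i\<in>I - {i0}. \<alpha> b i * x' i)"
        using i0 insert.prems by (simp add: sum.remove)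
      also have "(\<Sum>i\<in>I - {i0}. \<alpha> b i * x' i) = (\<Sum>i\<in>I - {i0}. \<alpha> b i * x i)"
        by (intro sum.cong) (auto simp: x'_def)
      finally show ?thesis by (simp add: x'_def)
    qed
    have "(\<Sum>i\<in>I. \<alpha> b i * x' i) = 0" if "b \<in> A" for b
    proof -
      have "0 = (\<Sum>i\<in>I - {i0}. \<alpha> b i * x i - \<alpha> b i0 / \<alpha> a i0 * (\<alpha> a i * x i))"
        using bspec[OF x(2) that] by (simp add: \<beta>_def algebra_simps)
      also have "\<dots> = (\<Sum>i\<in>I - {i0}. \<alpha> b i * x i) - \<alpha> b i0 / \<alpha> a i0 * S"
        by (simp add: sum_subtractf S_def sum_distrib_left)
      finally show ?thesis by (simp add: split)
    qed
    moreover have "(\<Sum>i\<in>I. \<alpha> a i * x' i) = 0"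
      using i0 by (simp add: split S_def)
    moreover have "\<exists>i\<in>I. x' i \<noteq> 0"
      using x(1) by (auto simp: x'_def)
    ultimately show ?thesis by (intro exI[of _ x']) auto
  qed
qed

text \<open>Discrete Green formula. The condition on h symmetrizes the matrix, so the sum telescopes
  to boundary terms. In the uses below the term at 0 vanishes because the entries 0 do, the other by
  finite support or in the limit.\<close>

lemma tridiagonal_symmetric:
  fixes h b c y w :: "nat \<Rightarrow> 'a :: comm_ring"
  assumes "\<And>k. k \<ge> 1 \<Longrightarrow> h (Suc k) = c k * h k"
  shows "(\<Sum>k=1..N. h k * ((y (k-1) - b k * y k + c k * y (k+1)) * w k
                            - y k * (w (k-1) - b k * w k + c k * w (k+1))))
       = h 1 * (y 0 * w 1 - y 1 * w 0) + h (Suc N) * (y (Suc N) * w N - y N * w (Suc N))"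
proof (induction N)
  case 0
  show ?case by (simp add: algebra_simps)
next
  case (Suc N)
  show ?case using assms[of "Suc N"]
    by (simp only: sum.cl_ivl_Suc Suc) (simp add: algebra_simps)
qed

text \<open>The vectors live on the indices k >= 1; entry 0 is only a boundary value. The
  normalization is weight 1 at index 1.\<close>

definition weight :: "(nat \<Rightarrow> real) \<Rightarrow> nat \<Rightarrow> real" where
  "weight c k = (\<Prod>j=1..<k. c j)"

lemma weight_1 [simp]: "weight c (Suc 0) = 1"
  by (simp add: weight_def)

lemma weight_Suc: "k \<ge> 1 \<Longrightarrow> weight c (Suc k) = c k * weight c k"
  by (simp add: weight_def prod.atLeastLessThan_Suc)

text \<open>For k >= 1, \<open>jacobi_power b c (Suc n) k\<close> is entry k of J^n e_1, where J is
  the tridiagonal matrix on the indices k >= 1. The extra start vector e_0 makes entry (n, k) the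
  n-th Taylor coefficient of y k / y 0, see \<open>ladder_fps_coeff\<close>.\<close>

primrec jacobi_power :: "(nat \<Rightarrow> real) \<Rightarrow> (nat \<Rightarrow> real) \<Rightarrow> nat \<Rightarrow> nat \<Rightarrow> real" where
  "jacobi_power b c 0 = (\<lambda>k. if k = 0 then 1 else 0)"
| "jacobi_power b c (Suc n) = (\<lambda>k. if k = 0 then 0 else
     jacobi_power b c n (k-1) - b k * jacobi_power b c n k + c k * jacobi_power b c n (k+1))"

lemma jacobi_power_eq_0: "n < k \<Longrightarrow> jacobi_power b c n k = 0"
  by (induction n arbitrary: k) auto

lemma jacobi_power_diag: "jacobi_power b c n n = 1"
  by (induction n) (auto simp: jacobi_power_eq_0)

text \<open>J is symmetric for the weights. The boundary terms vanish: at 0 since i, j >= 1, at the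
  upper end since \<open>T i\<close> and \<open>T j\<close> are supported on indices up to
  N.\<close>

lemma jacobi_power_shift:
  fixes b c :: "nat \<Rightarrow> real"
  defines "T \<equiv> jacobi_power b c" and "h \<equiv> weight c"
  assumes "i \<ge> 1" "j \<ge> 1" "i \<le> N" "j \<le> N"
  shows "(\<Sum>k=1..N. h k * (T (Suc i) k * T j k)) = (\<Sum>k=1..N. h k * (T i k * T (Suc j) k))"
proof -
  have z: "T i 0 = 0" "T j 0 = 0"
    using assms by (auto simp: T_def gr0_conv_Suc Suc_le_eq)
  have "(\<Sum>k=1..N. h k * (T (Suc i) k * T j k)) - (\<Sum>k=1..N. h k * (T i k * T (Suc j) k))
      = (\<Sum>k=1..N. h k * ((T i (k-1) - b k * T i k + c k * T i (k+1)) * T j k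
                            - T i k * (T j (k-1) - b k * T j k + c k * T j (k+1))))"
    unfolding sum_subtractf[symmetric] T_def by (intro sum.cong) (auto simp: algebra_simps)
  also have "\<dots> = 0"
    unfolding h_def by (subst tridiagonal_symmetric) (use assms in \<open>auto simp: weight_Suc z[unfolded T_def] jacobi_power_eq_0 T_def\<close>)
  finally show ?thesis by simp
qed

text \<open>The powers of J are moved one by one to the other factor until e_1 remains. Since
  \<open>jacobi_power\<close> is unit triangular, this is a congruence between the Hankel matrix of
  the moments and the diagonal matrix of the weights, so finite sections inherit the signs of the
  weights.\<close>

lemma hankel_factorization:
  fixes b c :: "nat \<Rightarrow> real"
  defines "T \<equiv> jacobi_power b c" and "h \<equiv> weight c"
  assumes "i + j < N"
  shows "(\<Sum>k=1..N. h k * (T (Suc i) k * T (Suc j) k)) = T (Suc (i + j)) 1"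
  using assms(3)
proof (induction j arbitrary: i)
  case 0
  have "(\<Sum>k=1..N. h k * (T (Suc i) k * T (Suc 0) k)) = (\<Sum>k=1..N. if k = 1 then T (Suc i) 1 else 0)"
    by (intro sum.cong) (auto simp: T_def h_def)
  then show ?case using 0 by simp
next
  case (Suc j)
  have "(\<Sum>k=1..N. h k * (T (Suc i) k * T (Suc (Suc j)) k)) = (\<Sum>k=1..N. h k * (T (Suc (Suc i)) k * T (Suc j) k))"
    unfolding T_def h_def by (rule jacobi_power_shift [symmetric]) (use Suc in auto)
  also have "\<dots> = T (Suc (Suc i + j)) 1" using Suc by (intro Suc.IH) auto
  finally show ?case by simp
qed

lemma hankel_form:
  fixes b c :: "nat \<Rightarrow> real" and x :: "nat \<Rightarrow> real"
  defines "T \<equiv> jacobi_power b c" and "h \<equiv> weight c"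
  assumes "p + j \<le> N"
  shows "(\<Sum>i<p. x i * T (Suc (i + j)) 1) = (\<Sum>k=1..N. h k * (\<Sum>i<p. x i * T (Suc i) k) * T (Suc j) k)"
proof -
  have "(\<Sum>i<p. x i * T (Suc (i + j)) 1) = (\<Sum>i<p. x i * (\<Sum>k=1..N. h k * (T (Suc i) k * T (Suc j) k)))"
    unfolding T_def h_def using assms by (intro sum.cong refl) (subst hankel_factorization, auto)
  also have "\<dots> = (\<Sum>i<p. \<Sum>k=1..N. h k * (x i * T (Suc i) k) * T (Suc j) k)"
    by (simp add: sum_distrib_left mult_ac)
  also have "\<dots> = (\<Sum>k=1..N. \<Sum>i<p. h k * (x i * T (Suc i) k) * T (Suc j) k)"
    by (rule sum.swap)
  also have "\<dots> = (\<Sum>k=1..N. h k * (\<Sum>i<p. x i * T (Suc i) k) * T (Suc j) k)"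
    by (simp add: sum_distrib_left sum_distrib_right)
  finally show ?thesis .
qed

lemma jacobi_power_independent:
  assumes "\<And>k. k \<ge> 1 \<Longrightarrow> k \<le> p \<Longrightarrow> (\<Sum>i<p. x i * jacobi_power b c (Suc i) k) = 0" "i < p"
  shows "x i = 0"
  using assms
proof (induction p)
  case (Suc p)
  have 0: "(\<Sum>i<p. x i * jacobi_power b c (Suc i) (Suc p)) = 0"
    by (intro sum.neutral) (auto simp del: jacobi_power.simps simp: jacobi_power_eq_0)
  have "x p = 0"
    using Suc.prems(1)[of "Suc p"] 0 by (simp del: jacobi_power.simps add: jacobi_power_diag)
  moreover have "x i = 0" if "i < p"
    using Suc.IH Suc.prems(1) that \<open>x p = 0\<close> by simp
  ultimately show ?case using Suc.prems(2) by (cases "i = p") auto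
qed auto

text \<open>Row k - 1 tests U against a vector supported up to k with last entry 1. As no weight is
  0, the entries of U vanish one after the other.\<close>

lemma hankel_nondegenerate:
  fixes b c :: "nat \<Rightarrow> real" and x :: "nat \<Rightarrow> real"
  assumes c: "\<And>k. k \<ge> 1 \<Longrightarrow> c k \<noteq> 0"
    and H: "\<And>j. (\<Sum>i<p. x i * jacobi_power b c (Suc (i + j)) 1) = 0" and "i < p"
  shows "x i = 0"
proof (rule jacobi_power_independent[OF _ \<open>i < p\<close>])
  fix k :: nat assume "k \<ge> 1"
  define U where "U = (\<lambda>k. \<Sum>i<p. x i * jacobi_power b c (Suc i) k)"
  have "U k = 0" if "k \<ge> 1" for k
    using that
  proof (induction k rule: less_induct)
    case (less k)
    then obtain j where j: "k = Suc j" by (cases k) auto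
    have "0 = (\<Sum>l=1..p + k. weight c l * U l * jacobi_power b c (Suc j) l)"
      unfolding U_def by (subst hankel_form[symmetric]) (use H[of j] j in auto)
    also have "\<dots> = (\<Sum>l=1..p + k. if l = k then weight c k * U k else 0)"
    proof (intro sum.cong refl)
      fix l assume "l \<in> {1..p + k}"
      then show "weight c l * U l * jacobi_power b c (Suc j) l = (if l = k then weight c k * U k else 0)"
        using less.IH[of l] unfolding j[symmetric]
        by (cases l k rule: linorder_cases) (auto simp: jacobi_power_eq_0 jacobi_power_diag)
    qed
    also have "\<dots> = weight c k * U k" using less.prems by simp
    finally show ?case using c by (simp add: weight_def)
  qed
  then show "(\<Sum>i<p. x i * jacobi_power b c (Suc i) k) = 0" using \<open>k \<ge> 1\<close> by (simp add: U_def)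
qed

text \<open>The form equals the weighted sum of the squares of U, which is supported on k <= p. The
  weight at p involves only the entries of c before p, so c p itself may be negative; this happens
  in the application, where p = s.\<close>

lemma hankel_positive:
  fixes b c :: "nat \<Rightarrow> real" and x :: "nat \<Rightarrow> real"
  assumes c: "\<And>k. k \<ge> 1 \<Longrightarrow> k < p \<Longrightarrow> c k > 0" and x: "i < p" "x i \<noteq> 0"
  shows "(\<Sum>j<p. \<Sum>i<p. x i * x j * jacobi_power b c (Suc (i + j)) 1) > 0"
proof -
  define U where "U = (\<lambda>k. \<Sum>i<p. x i * jacobi_power b c (Suc i) k)"
  have h: "weight c k > 0" if "k \<le> p" for k
    using that unfolding weight_def by (intro prod_pos) (auto intro: c)
  have U0: "U k = 0" if "k > p" for k
    using that by (auto simp: U_def jacobi_power_eq_0 simp del: jacobi_power.simps intro!: sum.neutral)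
  have "(\<Sum>j<p. \<Sum>i<p. x i * x j * jacobi_power b c (Suc (i + j)) 1)
      = (\<Sum>j<p. x j * (\<Sum>i<p. x i * jacobi_power b c (Suc (i + j)) 1))"
    by (simp add: sum_distrib_left mult_ac del: jacobi_power.simps)
  also have "\<dots> = (\<Sum>j<p. x j * (\<Sum>k=1..2*p. weight c k * U k * jacobi_power b c (Suc j) k))"
    unfolding U_def by (intro sum.cong refl) (subst hankel_form[where N = "2 * p"], auto)
  also have "\<dots> = (\<Sum>j<p. \<Sum>k=1..2*p. weight c k * U k * (x j * jacobi_power b c (Suc j) k))"
    by (simp add: sum_distrib_left mult_ac del: jacobi_power.simps)
  also have "\<dots> = (\<Sum>k=1..2*p. \<Sum>j<p. weight c k * U k * (x j * jacobi_power b c (Suc j) k))"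
    by (rule sum.swap)
  also have "\<dots> = (\<Sum>k=1..2*p. weight c k * (U k)\<^sup>2)"
    by (simp add: sum_distrib_left[symmetric] U_def power2_eq_square mult.assoc del: jacobi_power.simps)
  also have "\<dots> > 0"
  proof -
    obtain k where k: "1 \<le> k" "k \<le> p" "U k \<noteq> 0"
      using jacobi_power_independent[of p x b c i] x unfolding U_def by blast
    have nn: "weight c l * (U l)\<^sup>2 \<ge> 0" for l
      using h[of l] U0[of l] by (cases "l \<le> p") auto
    have "0 < weight c k * (U k)\<^sup>2" using h k by simp
    also have "\<dots> \<le> (\<Sum>k=1..2*p. weight c k * (U k)\<^sup>2)"
      using k nn by (intro member_le_sum) auto
    finally show ?thesis .
  qed
  finally show ?thesis .
qed

section \<open>An upper bound for the number of zeros in the upper half plane\<close>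

text \<open>The quotients of consecutive terms tend to 0, so the weights beat every geometric growth
  of eigenvectors.\<close>

lemma weight_mult_power_tendsto_0:
  fixes c :: "nat \<Rightarrow> real"
  assumes c: "c \<longlonglongrightarrow> 0"
  shows "(\<lambda>k. weight c k * R ^ k) \<longlonglongrightarrow> 0"
proof (rule summable_LIMSEQ_zero)
  have "(\<lambda>k. c k * R) \<longlonglongrightarrow> 0" using tendsto_mult_left_zero[OF c] by simp
  then have "eventually (\<lambda>k. norm (c k * R) < 1/2) sequentially"
    by (intro order_tendstoD(2)[OF tendsto_norm_zero]) auto
  then obtain N where N: "\<And>k. k \<ge> N \<Longrightarrow> norm (c k * R) < 1/2"
    by (auto simp: eventually_sequentially)
  show "summable (\<lambda>k. weight c k * R ^ k)"
  proof (rule summable_ratio_test)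
    show "norm (weight c (Suc k) * R ^ Suc k) \<le> 1/2 * norm (weight c k * R ^ k)" if "k \<ge> max N 1" for k
    proof -
      have "norm (weight c (Suc k) * R ^ Suc k) = norm (c k * R) * norm (weight c k * R ^ k)"
        using that by (simp add: weight_Suc abs_mult)
      also have "\<dots> \<le> 1/2 * norm (weight c k * R ^ k)"
        using N[of k] that by (intro mult_right_mono) auto
      finally show ?thesis .
    qed
  qed simp
qed

definition ladder :: "real \<Rightarrow> real \<Rightarrow> complex \<Rightarrow> nat \<Rightarrow> complex" where
  "ladder L \<eta> z k = z ^ k * phi (L + real k) \<eta> z"

definition ladder_b :: "real \<Rightarrow> real \<Rightarrow> nat \<Rightarrow> real" where
  "ladder_b L \<eta> k = lower_b (L + real k) \<eta>"

definition ladder_c :: "real \<Rightarrow> real \<Rightarrow> nat \<Rightarrow> real" where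
  "ladder_c L \<eta> k = lower_c (L + real k) \<eta>"

abbreviation ladder_weight :: "real \<Rightarrow> real \<Rightarrow> nat \<Rightarrow> real" where
  "ladder_weight L \<eta> \<equiv> weight (ladder_c L \<eta>)"

lemma ladder_0: "ladder L \<eta> z 0 = phi L \<eta> z"
  by (simp add: ladder_def)

lemma ladder_cnj: "ladder L \<eta> (cnj z) k = cnj (ladder L \<eta> z k)"
  by (simp add: ladder_def phi_cnj)

text \<open>This holds at every z \<noteq> 0. Only the row k = 1 contains entry 0, which is
  \<open>phi L \<eta> z\<close>; at a zero the entries from index 1 on therefore form an eigenvector
  by themselves.\<close>

lemma ladder_rec:
  assumes "admissible L \<eta>" "z \<noteq> 0" "k \<ge> 1"
  shows "ladder L \<eta> z (k-1) - of_real (ladder_b L \<eta> k) * ladder L \<eta> z k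
           + of_real (ladder_c L \<eta> k) * ladder L \<eta> z (k+1) = ladder L \<eta> z k / z"
proof -
  obtain j where k: "k = Suc j" using assms(3) by (cases k) auto
  have "admissible (L + real k - 1) \<eta>" "admissible (L + real k) \<eta>"
    using admissible_add[OF assms(1), of j] admissible_add[OF assms(1), of k] by (simp_all add: k)
  then have "phi (L + real k - 1) \<eta> z = (1 + of_real (lower_b (L + real k) \<eta>) * z) * phi (L + real k) \<eta> z
           - of_real (lower_c (L + real k) \<eta>) * z ^ 2 * phi (L + real k + 1) \<eta> z"
    by (rule phi_lower)
  then have "phi (L + real j) \<eta> z = (1 + of_real (ladder_b L \<eta> k) * z) * phi (L + real k) \<eta> z
           - of_real (ladder_c L \<eta> k) * z ^ 2 * phi (L + real (k + 1)) \<eta> z"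
    by (simp add: k ladder_b_def ladder_c_def add_ac)
  then show ?thesis using assms(2) by (simp add: ladder_def k) (simp add: algebra_simps power2_eq_square)
qed

lemma ladder_bounded:
  obtains C where "C > 0" "\<And>k. norm (ladder L \<eta> z k) \<le> C * norm z ^ k"
proof -
  have "Bseq (\<lambda>k. phi (L + real k) \<eta> z)"
    using phi_tendsto_1[of L \<eta> z] by (intro convergent_imp_Bseq) (auto simp: convergent_def)
  then obtain C where "C > 0" "\<And>k. norm (phi (L + real k) \<eta> z) \<le> C" by (auto elim: BseqE)
  then show ?thesis
    by (intro that[of C]) (auto simp: ladder_def norm_mult norm_power mult.commute[of "norm z ^ _"] intro!: mult_right_mono)
qed

lemma ladder_c_tendsto_0: "ladder_c L \<eta> \<longlonglongrightarrow> 0"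
proof -
  have "(\<lambda>k. (1 + (\<eta> * (1 / (L + real k + 1)))\<^sup>2) * (1 / (2 * (L + real k) + 3)) * (1 / (2 * (L + real k) + 1)))
          \<longlonglongrightarrow> (1 + (\<eta> * 0)\<^sup>2) * 0 * 0"
    by (intro tendsto_intros; real_asymp)
  then show ?thesis by (simp add: ladder_c_def[abs_def] lower_c_def lower_d_def)
qed

(* Eigenvectors of a symmetric tridiagonal operator for different eigenvalues 1/z and 1/w are
   orthogonal; here only the partial sums are needed. *)
lemma ladder_orthogonal:
  assumes L: "admissible L \<eta>" and z: "z \<noteq> 0" "phi L \<eta> z = 0" and w: "w \<noteq> 0" "phi L \<eta> w = 0"
    and "z \<noteq> w"
  shows "(\<lambda>N. \<Sum>k=1..N. of_real (ladder_weight L \<eta> k) * (ladder L \<eta> z k * ladder L \<eta> w k)) \<longlonglongrightarrow> 0"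
proof -
  let ?h = "\<lambda>k. complex_of_real (ladder_weight L \<eta> k)"
  let ?y = "ladder L \<eta> z" and ?w = "ladder L \<eta> w"
  let ?b = "\<lambda>k. complex_of_real (ladder_b L \<eta> k)" and ?c = "\<lambda>k. complex_of_real (ladder_c L \<eta> k)"
  have zw: "1 / z - 1 / w \<noteq> 0" using assms by (simp add: field_simps)
  have eq: "(1 / z - 1 / w) * (\<Sum>k=1..N. ?h k * (?y k * ?w k)) =
      ?h (Suc N) * (?y (Suc N) * ?w N - ?y N * ?w (Suc N))" for N
  proof -
    have "(1 / z - 1 / w) * (\<Sum>k=1..N. ?h k * (?y k * ?w k)) =
       (\<Sum>k=1..N. ?h k * ((?y k / z) * ?w k - ?y k * (?w k / w)))"
      unfolding sum_distrib_left using z w by (intro sum.cong) (auto simp: field_simps)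
    also have "\<dots> = (\<Sum>k=1..N. ?h k * ((?y (k-1) - ?b k * ?y k + ?c k * ?y (k+1)) * ?w k
                            - ?y k * (?w (k-1) - ?b k * ?w k + ?c k * ?w (k+1))))"
    proof (intro sum.cong refl)
      fix k assume "k \<in> {1..N}"
      then have k: "k \<ge> 1" by simp
      show "?h k * ((?y k / z) * ?w k - ?y k * (?w k / w)) =
        ?h k * ((?y (k-1) - ?b k * ?y k + ?c k * ?y (k+1)) * ?w k
                            - ?y k * (?w (k-1) - ?b k * ?w k + ?c k * ?w (k+1)))"
        by (simp only: ladder_rec[OF L z(1) k] ladder_rec[OF L w(1) k])
    qed
    also have "\<dots> = ?h 1 * (?y 0 * ?w 1 - ?y 1 * ?w 0) + ?h (Suc N) * (?y (Suc N) * ?w N - ?y N * ?w (Suc N))"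
      by (rule tridiagonal_symmetric) (simp add: weight_Suc)
    finally show ?thesis using z w by (simp add: ladder_0)
  qed
  obtain C where C: "C > 0" "\<And>k. norm (?y k) \<le> C * norm z ^ k" by (rule ladder_bounded) blast
  obtain D where D: "D > 0" "\<And>k. norm (?w k) \<le> D * norm w ^ k" by (rule ladder_bounded) blast
  define R where "R = norm z * norm w"
  have R: "R > 0" using z w by (simp add: R_def)
  \<comment> \<open>The boundary term at 0 is gone because z and w are zeros. The one at N is a
    weight times a quantity of order at most R^N.\<close>
  have lim: "(\<lambda>N. ?h (Suc N) * (?y (Suc N) * ?w N - ?y N * ?w (Suc N))) \<longlonglongrightarrow> 0"
  proof (rule Lim_null_comparison)
    show "eventually (\<lambda>N. norm (?h (Suc N) * (?y (Suc N) * ?w N - ?y N * ?w (Suc N))) \<le>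
       norm (ladder_weight L \<eta> (Suc N) * R ^ Suc N) * (C * D * (1 / norm w + 1 / norm z))) sequentially"
    proof (rule always_eventually, rule allI)
      fix N
      have "norm (?y (Suc N) * ?w N - ?y N * ?w (Suc N)) \<le> norm (?y (Suc N)) * norm (?w N) + norm (?y N) * norm (?w (Suc N))"
        by (rule order_trans[OF norm_triangle_ineq4]) (simp add: norm_mult)
      also have "\<dots> \<le> (C * norm z ^ Suc N) * (D * norm w ^ N) + (C * norm z ^ N) * (D * norm w ^ Suc N)"
        using C D by (intro add_mono mult_mono) (auto intro: mult_nonneg_nonneg less_imp_le simp del: power_Suc)
      also have "\<dots> = R ^ Suc N * (C * D * (1 / norm w + 1 / norm z))"
        using z w by (simp add: R_def power_mult_distrib field_simps)
      finally show "norm (?h (Suc N) * (?y (Suc N) * ?w N - ?y N * ?w (Suc N))) \<le>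
       norm (ladder_weight L \<eta> (Suc N) * R ^ Suc N) * (C * D * (1 / norm w + 1 / norm z))"
        using R by (simp add: norm_mult abs_mult mult.assoc mult_left_mono)
    qed
    have "(\<lambda>N. ladder_weight L \<eta> (Suc N) * R ^ Suc N) \<longlonglongrightarrow> 0"
      using LIMSEQ_Suc[OF weight_mult_power_tendsto_0[OF ladder_c_tendsto_0]] .
    then have "(\<lambda>N. norm (ladder_weight L \<eta> (Suc N) * R ^ Suc N)) \<longlonglongrightarrow> 0"
      by (rule tendsto_norm_zero)
    then show "(\<lambda>N. norm (ladder_weight L \<eta> (Suc N) * R ^ Suc N) * (C * D * (1 / norm w + 1 / norm z))) \<longlonglongrightarrow> 0"
      by (rule tendsto_mult_left_zero)
  qed
  have "(\<lambda>N. (1 / (1 / z - 1 / w)) * ((1 / z - 1 / w) * (\<Sum>k=1..N. ?h k * (?y k * ?w k)))) \<longlonglongrightarrow> 0"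
    unfolding eq by (rule tendsto_mult_right_zero[OF lim])
  then show ?thesis using zw by simp
qed

text \<open>Independence of eigenvectors for distinct eigenvalues: applying the operator repeatedly
  to a vanishing combination inserts any polynomial in 1/a. The polynomial p kills all eigenvalues
  but one, and the vector left over is nonzero because phi_{L+k} tends to 1.\<close>

lemma ladder_independent:
  assumes L: "admissible L \<eta>" and A: "finite A" "\<And>a. a \<in> A \<Longrightarrow> a \<noteq> 0 \<and> phi L \<eta> a = 0"
    and V: "\<And>k. k \<ge> 1 \<Longrightarrow> (\<Sum>a\<in>A. x a * ladder L \<eta> a k) = 0" and "a \<in> A"
  shows "x a = 0"
proof -
  have pw: "(\<Sum>a\<in>A. x a * (1 / a) ^ n * ladder L \<eta> a k) = 0" for n k
  proof (induction n arbitrary: k)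
    case 0
    show ?case using V[of k] A by (cases k) (auto simp: ladder_0)
  next
    case (Suc n)
    show ?case
    proof (cases k)
      case 0
      then show ?thesis using A by (auto simp: ladder_0 intro: sum.neutral)
    next
      case (Suc j)
      have "(\<Sum>a\<in>A. x a * (1 / a) ^ Suc n * ladder L \<eta> a k) = (\<Sum>a\<in>A. x a * (1 / a) ^ n * (ladder L \<eta> a k / a))"
        by (intro sum.cong) auto
      also have "\<dots> = (\<Sum>a\<in>A. x a * (1 / a) ^ n * (ladder L \<eta> a (k-1) - of_real (ladder_b L \<eta> k) * ladder L \<eta> a k
           + of_real (ladder_c L \<eta> k) * ladder L \<eta> a (k+1)))"
        using A Suc by (intro sum.cong refl) (subst ladder_rec[OF L], auto)
      also have "\<dots> = (\<Sum>a\<in>A. x a * (1 / a) ^ n * ladder L \<eta> a (k-1))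
            - of_real (ladder_b L \<eta> k) * (\<Sum>a\<in>A. x a * (1 / a) ^ n * ladder L \<eta> a k)
            + of_real (ladder_c L \<eta> k) * (\<Sum>a\<in>A. x a * (1 / a) ^ n * ladder L \<eta> a (k+1))"
        by (simp add: sum_distrib_left algebra_simps sum.distrib sum_subtractf)
      also have "\<dots> = 0" unfolding Suc.IH by simp
      finally show ?thesis .
    qed
  qed
  have poly: "(\<Sum>a\<in>A. x a * poly p (1 / a) * ladder L \<eta> a k) = 0" for p k
  proof -
    have "(\<Sum>a\<in>A. x a * poly p (1 / a) * ladder L \<eta> a k) =
       (\<Sum>a\<in>A. \<Sum>n\<le>degree p. coeff p n * (x a * (1 / a) ^ n * ladder L \<eta> a k))"
      unfolding poly_altdef sum_distrib_left sum_distrib_right by (intro sum.cong) auto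
    also have "\<dots> = (\<Sum>n\<le>degree p. coeff p n * (\<Sum>a\<in>A. x a * (1 / a) ^ n * ladder L \<eta> a k))"
      by (subst sum.swap) (simp add: sum_distrib_left)
    finally show ?thesis by (simp only: pw) simp
  qed
  define p where "p = (\<Prod>b\<in>A - {a}. [:- (1 / b), 1:])"
  have p0: "poly p (1 / b) = 0" if "b \<in> A - {a}" for b
    using that A by (auto simp: p_def poly_prod)
  have p1: "poly p (1 / a) \<noteq> 0"
    using A \<open>a \<in> A\<close> by (auto simp: p_def poly_prod)
  have eq: "x a * poly p (1 / a) * ladder L \<eta> a k = 0" for k
  proof -
    have "x a * poly p (1 / a) * ladder L \<eta> a k + (\<Sum>b\<in>A - {a}. x b * poly p (1 / b) * ladder L \<eta> b k) = 0"
      using poly[of p k] A \<open>a \<in> A\<close> by (simp add: sum.remove)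
    then show ?thesis using p0 by simp
  qed
  have "eventually (\<lambda>k. norm (phi (L + real k) \<eta> a) > 1/2) sequentially"
    using order_tendstoD(1)[OF tendsto_norm[OF phi_tendsto_1[of L \<eta> a]], of "1/2"] by simp
  then obtain k where "norm (phi (L + real k) \<eta> a) > 1/2"
    by (auto simp: eventually_sequentially)
  then have "ladder L \<eta> a k \<noteq> 0" using A \<open>a \<in> A\<close> by (auto simp: ladder_def)
  then show ?thesis using eq[of k] p1 by simp
qed

(* Eigenvectors for eigenvalues in the lower half plane span a neutral subspace, whose dimension
   is at most the number of weights of either sign. *)
lemma card_upper_zeros_le:
  assumes L: "admissible L \<eta>" and A: "finite A" "\<And>a. a \<in> A \<Longrightarrow> Im a > 0 \<and> phi L \<eta> a = 0"
    and h: "\<And>k. k > s \<Longrightarrow> \<sigma> * ladder_weight L \<eta> k > 0"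
  shows "card A \<le> s"
proof (rule ccontr)
  assume "\<not> card A \<le> s"
  then have "card {1..s} < card A" by simp
  \<comment> \<open>More than s vectors allow a nontrivial combination whose first s entries
    vanish.\<close>
  then obtain x where x: "\<exists>a\<in>A. x a \<noteq> 0" "\<forall>k\<in>{1..s}. (\<Sum>a\<in>A. ladder L \<eta> a k * x a) = 0"
    using homogeneous_system_nontrivial[of "{1..s}" A "\<lambda>k a. ladder L \<eta> a k"] A by auto
  define V where "V k = (\<Sum>a\<in>A. x a * ladder L \<eta> a k)" for k
  have nz: "a \<noteq> 0 \<and> phi L \<eta> a = 0" if "a \<in> A" for a using A(2)[OF that] by auto
  \<comment> \<open>Conjugating the vector of b gives that of \<open>cnj b\<close>, in the opposite
    half plane; so a and \<open>cnj b\<close> always differ, even for a = b, and every entry of the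
    Gram matrix tends to 0.\<close>
  have "(\<lambda>N. \<Sum>a\<in>A. \<Sum>b\<in>A. x a * cnj (x b) *
      (\<Sum>k=1..N. of_real (ladder_weight L \<eta> k) * (ladder L \<eta> a k * ladder L \<eta> (cnj b) k))) \<longlonglongrightarrow> 0"
  proof (intro tendsto_null_sum tendsto_mult_right_zero ladder_orthogonal L)
    fix a b assume ab: "a \<in> A" "b \<in> A"
    then show "a \<noteq> 0" "phi L \<eta> a = 0" "cnj b \<noteq> 0" "phi L \<eta> (cnj b) = 0"
      using nz by (auto simp: phi_cnj)
    have "Im a > 0" "Im (cnj b) < 0" using ab A by auto
    then show "a \<noteq> cnj b" by force
  qed
  moreover have "(\<Sum>a\<in>A. \<Sum>b\<in>A. x a * cnj (x b) *
      (\<Sum>k=1..N. of_real (ladder_weight L \<eta> k) * (ladder L \<eta> a k * ladder L \<eta> (cnj b) k)))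
      = of_real (\<Sum>k=1..N. ladder_weight L \<eta> k * (norm (V k))\<^sup>2)" for N
  proof -
    have "(\<Sum>a\<in>A. \<Sum>b\<in>A. x a * cnj (x b) *
      (\<Sum>k=1..N. of_real (ladder_weight L \<eta> k) * (ladder L \<eta> a k * ladder L \<eta> (cnj b) k)))
      = (\<Sum>a\<in>A. \<Sum>b\<in>A. \<Sum>k=1..N. of_real (ladder_weight L \<eta> k) * ((x a * ladder L \<eta> a k) * cnj (x b * ladder L \<eta> b k)))"
      by (simp add: sum_distrib_left ladder_cnj mult_ac)
    also have "\<dots> = (\<Sum>a\<in>A. \<Sum>k=1..N. \<Sum>b\<in>A. of_real (ladder_weight L \<eta> k) * ((x a * ladder L \<eta> a k) * cnj (x b * ladder L \<eta> b k)))"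
      by (intro sum.cong refl sum.swap)
    also have "\<dots> = (\<Sum>k=1..N. \<Sum>a\<in>A. \<Sum>b\<in>A. of_real (ladder_weight L \<eta> k) * ((x a * ladder L \<eta> a k) * cnj (x b * ladder L \<eta> b k)))"
      by (rule sum.swap)
    also have "\<dots> = (\<Sum>k=1..N. of_real (ladder_weight L \<eta> k) * (V k * cnj (V k)))"
      unfolding V_def cnj_sum sum_product by (simp add: sum_distrib_left)
    also have "\<dots> = of_real (\<Sum>k=1..N. ladder_weight L \<eta> k * (norm (V k))\<^sup>2)"
      by (simp add: complex_norm_square del: of_real_power)
    finally show ?thesis .
  qed
  ultimately have "(\<lambda>N. complex_of_real (\<Sum>k=1..N. ladder_weight L \<eta> k * (norm (V k))\<^sup>2)) \<longlonglongrightarrow> of_real 0"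
    by simp
  then have lim: "(\<lambda>N. \<Sum>k=1..N. ladder_weight L \<eta> k * (norm (V k))\<^sup>2) \<longlonglongrightarrow> 0"
    by (simp only: tendsto_of_real_iff)
  then have lim': "(\<lambda>N. \<sigma> * (\<Sum>k=1..N. ladder_weight L \<eta> k * (norm (V k))\<^sup>2)) \<longlonglongrightarrow> 0"
    by (rule tendsto_mult_right_zero)
  have V0: "V k = 0" if "1 \<le> k" "k \<le> s" for k
    using x(2) that by (simp add: V_def mult.commute)
  have nn: "\<sigma> * (ladder_weight L \<eta> k * (norm (V k))\<^sup>2) \<ge> 0" if "k \<ge> 1" for k
  proof (cases "k \<le> s")
    case False
    have "\<sigma> * ladder_weight L \<eta> k * (norm (V k))\<^sup>2 \<ge> 0"
      by (rule mult_nonneg_nonneg) (use h[of k] False in auto)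
    then show ?thesis by (simp add: mult.assoc)
  qed (use V0 that in auto)
  \<comment> \<open>The terms all have the sign of \<sigma> or vanish, and their partial sums tend
    to 0, so no term can be nonzero.\<close>
  have "V k = 0" if k: "k \<ge> 1" for k
  proof (rule ccontr)
    assume Vk: "V k \<noteq> 0"
    then have "k > s" using V0 k by fastforce
    have "0 < \<sigma> * ladder_weight L \<eta> k * (norm (V k))\<^sup>2"
      by (rule mult_pos_pos) (use h[OF \<open>k > s\<close>] Vk in auto)
    moreover have "\<sigma> * ladder_weight L \<eta> k * (norm (V k))\<^sup>2 \<le> 0"
    proof (rule LIMSEQ_le_const[OF lim'], intro exI allI impI)
      fix N assume "k \<le> N"
      then have "\<sigma> * (ladder_weight L \<eta> k * (norm (V k))\<^sup>2) \<le> (\<Sum>k=1..N. \<sigma> * (ladder_weight L \<eta> k * (norm (V k))\<^sup>2))"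
        using k nn by (intro member_le_sum) auto
      then show "\<sigma> * ladder_weight L \<eta> k * (norm (V k))\<^sup>2 \<le> \<sigma> * (\<Sum>k=1..N. ladder_weight L \<eta> k * (norm (V k))\<^sup>2)"
        by (simp add: sum_distrib_left mult.assoc)
    qed
    ultimately show False by simp
  qed
  then have "x a = 0" if "a \<in> A" for a
    using ladder_independent[OF L A(1) nz, of x a] that unfolding V_def by blast
  then show False using x(1) by blast
qed

section \<open>Simplicity of the zeros\<close>

lemma one_plus_square_nonzero: "1 + x\<^sup>2 \<noteq> (0::real)"
  by (smt (verit) zero_le_power2)

lemma ladder_c_nonzero:
  assumes "admissible L \<eta>" "k \<ge> 1"
  shows "ladder_c L \<eta> k \<noteq> 0"
proof -
  have "2 * (L + real k) + 3 \<noteq> 0" using admissible_nz(2)[OF assms(1), of k] by (simp add: algebra_simps)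
  moreover have "2 * (L + real k) + 1 \<noteq> 0"
    using admissible_nz(2)[OF assms(1), of "k - 1"] assms(2) by (simp add: algebra_simps of_nat_diff)
  ultimately show ?thesis by (simp add: ladder_c_def lower_c_def lower_d_def one_plus_square_nonzero)
qed

text \<open>At a multiple zero the derivative relation makes entry 1 vanish along with entry 0. As
  every c k is nonzero, the recurrence then annihilates the whole vector, contrary to
  \<open>ladder_independent\<close> for a single zero.\<close>

lemma phi_zeros_simple:
  assumes L: "admissible L \<eta>" and "phi L \<eta> z = 0"
  shows "deriv (phi L \<eta>) z \<noteq> 0"
proof
  assume d: "deriv (phi L \<eta>) z = 0"
  have z: "z \<noteq> 0" using assms(2) by auto
  have "lower_d L \<eta> \<noteq> 0"
    using admissible_nz(2)[OF L, of 0] by (simp add: lower_d_def one_plus_square_nonzero)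
  then have 1: "phi (L + 1) \<eta> z = 0"
    using d deriv_phi[OF L, of z] assms(2) z by simp
  have "ladder L \<eta> z k = 0 \<and> ladder L \<eta> z (Suc k) = 0" for k
  proof (induction k)
    case 0
    show ?case using assms(2) 1 by (simp add: ladder_def)
  next
    case (Suc k)
    then show ?case using ladder_rec[OF L z, of "Suc k"] ladder_c_nonzero[OF L, of "Suc k"] by simp
  qed
  then have "(1::complex) = 0" using ladder_independent[OF L, of "{z}" "\<lambda>_. 1" z] assms(2) z by simp
  then show False by simp
qed

section \<open>Power sums of the zeros of an entire function\<close>

text \<open>Borel-Caratheodory: a one-sided bound on the real part controls the modulus. Schwarz's
  lemma bounds H - H(0) on the disc of radius R/2, and Cauchy's inequality there produces the factor
  2/R.\<close>

lemma Borel_Caratheodory_coeff: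
  assumes H: "H holomorphic_on ball 0 R" "R > 0" "H has_fps_expansion F"
    and B: "\<And>z. norm z < R \<Longrightarrow> Re (H z) < B" "Re (H 0) \<ge> 0" and k: "k \<ge> 1"
  shows "norm (fps_nth F k) \<le> 2 * B * (2 / R) ^ k"
proof -
  define A where "A = B - Re (H 0)"
  have A: "A > 0" "A \<le> B" using B(1)[of 0] B(2) H(2) by (auto simp: A_def)
  define w where "w z = H (of_real R * z) - H 0" for z
  have in_ball: "of_real R * z \<in> ball 0 R" if "norm z < 1" for z :: complex
    using that H(2) by (simp add: norm_mult)
  have Re_w: "Re (w z) < A" if "norm z < 1" for z
    using B(1)[of "of_real R * z"] in_ball[OF that] by (simp add: w_def A_def)
  have holw: "w holomorphic_on ball 0 1"
  proof -
    have "H \<circ> (\<lambda>z. of_real R * z) holomorphic_on ball 0 1"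
      by (rule holomorphic_on_compose_gen[OF _ H(1)]) (use in_ball in \<open>auto intro!: holomorphic_intros\<close>)
    then show ?thesis unfolding w_def[abs_def] by (auto simp: o_def intro!: holomorphic_intros)
  qed
  have less: "norm u < norm (of_real (2 * A) - u)" if "Re u < A" for u
  proof -
    have "(norm u)\<^sup>2 < (norm (of_real (2 * A) - u))\<^sup>2"
    proof -
      have "(norm (of_real (2 * A) - u))\<^sup>2 - (norm u)\<^sup>2 = 4 * A * (A - Re u)"
        unfolding cmod_power2 by (simp add: power2_eq_square algebra_simps)
      also have "\<dots> > 0" using A that by simp
      finally show ?thesis by simp
    qed
    then show ?thesis by (rule power2_less_imp_less) simp
  qed
  \<comment> \<open>The Moebius map u / (2A - u) sends the half plane Re u < A into the unit disc
    and fixes 0; 2A is the mirror image of 0 in the line Re u = A.\<close>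
  define \<psi> where "\<psi> z = w z / (of_real (2 * A) - w z)" for z
  have nz: "of_real (2 * A) - w z \<noteq> 0" if "norm z < 1" for z
    using less[OF Re_w[OF that]] by auto
  have hol\<psi>: "\<psi> holomorphic_on ball 0 1"
    unfolding \<psi>_def[abs_def] using nz by (intro holomorphic_intros holw) auto
  have \<psi>_le: "norm (\<psi> z) \<le> norm z" if "norm z < 1" for z
  proof (rule Schwarz_Lemma(1)[OF hol\<psi> _ _ that])
    show "\<psi> 0 = 0" by (simp add: \<psi>_def w_def)
    show "norm (\<psi> z) < 1" if "norm z < 1" for z
      using less[OF Re_w[OF that]] nz[OF that] by (simp add: \<psi>_def norm_divide divide_simps)
  qed
  have w_le: "norm (w z) \<le> 2 * A" if z: "norm z \<le> 1/2" for z
  proof -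
    have n1: "norm z < 1" using z by simp
    have "norm (w z) = norm (\<psi> z) * norm (of_real (2 * A) - w z)"
      using nz[OF n1] by (simp add: \<psi>_def norm_divide)
    also have "\<dots> \<le> 1/2 * (2 * A + norm (w z))"
      using \<psi>_le[OF n1] z A norm_triangle_ineq4[of "of_real (2 * A)" "w z"]
      by (intro mult_mono) auto
    finally show ?thesis by simp
  qed
  have contH: "continuous_on (cball 0 (R/2)) (\<lambda>z. H z - H 0)"
    using H(2) by (intro continuous_intros holomorphic_on_imp_continuous_on[OF holomorphic_on_subset[OF H(1)]]) auto
  have "norm ((deriv ^^ k) (\<lambda>z. H z - H 0) 0) \<le> fact k * (2 * A) / (R/2) ^ k"
  proof (rule Cauchy_inequality)
    show "(\<lambda>z. H z - H 0) holomorphic_on ball 0 (R/2)"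
      using H(2) by (intro holomorphic_intros holomorphic_on_subset[OF H(1)]) auto
    show "norm (H x - H 0) \<le> 2 * A" if "norm (0 - x) = R/2" for x
      using w_le[of "x / of_real R"] that H(2) by (simp add: w_def norm_divide)
  qed (use contH H in auto)
  moreover have "(\<lambda>z. H z - H 0) has_fps_expansion F - fps_const (H 0)"
    by (intro fps_expansion_intros H)
  then have "fps_nth (F - fps_const (H 0)) k = (deriv ^^ k) (\<lambda>z. H z - H 0) 0 / fact k"
    by (rule fps_nth_fps_expansion)
  then have "fps_nth F k = (deriv ^^ k) (\<lambda>z. H z - H 0) 0 / fact k"
    using k by simp
  ultimately have "norm (fps_nth F k) \<le> 2 * A / (R/2) ^ k"
    by (simp add: norm_divide divide_le_eq mult.commute)
  also have "\<dots> = 2 * A * (2 / R) ^ k" by (simp add: power_divide)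
  also have "\<dots> \<le> 2 * B * (2 / R) ^ k"
    using A H(2) by (intro mult_right_mono) auto
  finally show ?thesis .
qed

lemma entire_factor_zeros:
  assumes "f holomorphic_on UNIV" "finite A" "\<And>a. a \<in> A \<Longrightarrow> f a = 0"
  obtains g where "g holomorphic_on UNIV" "\<And>z. f z = (\<Prod>a\<in>A. z - a) * g z"
proof -
  have "\<exists>g. g holomorphic_on UNIV \<and> (\<forall>z. f z = (\<Prod>a\<in>A. z - a) * g z)"
    using assms(2,3)
  proof (induction A rule: finite_induct)
    case empty
    then show ?case using assms(1) by auto
  next
    case (insert a A)
    then obtain g where g: "g holomorphic_on UNIV" "\<And>z. f z = (\<Prod>a\<in>A. z - a) * g z" by auto
    have "(\<Prod>b\<in>A. a - b) \<noteq> 0" using insert by auto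
    then have ga: "g a = 0" using g(2)[of a] insert.prems by auto
    define g1 where "g1 = (\<lambda>z. if z = a then deriv g a else (g z - g a) / (z - a))"
    have "g1 holomorphic_on UNIV"
      unfolding g1_def by (rule pole_lemma_open[OF g(1)]) auto
    moreover have "g z = (z - a) * g1 z" for z using ga by (auto simp: g1_def)
    then have "f z = (\<Prod>a\<in>insert a A. z - a) * g1 z" for z
      using insert g(2)[of z] by (simp add: mult_ac)
    ultimately show ?case by blast
  qed
  then show ?thesis using that by blast
qed

section \<open>Formal logarithmic derivatives, turning products into sums without a branch of the
  logarithm\<close>

definition fps_logderiv :: "complex fps \<Rightarrow> complex fps" where
  "fps_logderiv F = fps_deriv F * inverse F"

lemma fps_logderiv_mult:
  assumes "fps_nth F 0 \<noteq> 0" "fps_nth G 0 \<noteq> 0"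
  shows "fps_logderiv (F * G) = fps_logderiv F + fps_logderiv G"
proof -
  have 1: "F * inverse F = 1" "G * inverse G = 1"
    using assms inverse_mult_eq_1' by auto
  have "fps_logderiv (F * G) = fps_deriv F * inverse F * (G * inverse G) + fps_deriv G * inverse G * (F * inverse F)"
    by (simp add: fps_logderiv_def fps_inverse_mult algebra_simps)
  then show ?thesis unfolding 1 by (simp add: fps_logderiv_def)
qed

lemma fps_prod_nth_0: "fps_nth (\<Prod>a\<in>A. F a) 0 = (\<Prod>a\<in>A. fps_nth (F a) 0 :: complex)"
  by (induction A rule: infinite_finite_induct) auto

lemma fps_logderiv_prod:
  assumes "\<And>a. a \<in> A \<Longrightarrow> fps_nth (F a) 0 \<noteq> 0"
  shows "fps_logderiv (\<Prod>a\<in>A. F a) = (\<Sum>a\<in>A. fps_logderiv (F a))"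
  using assms
proof (induction A rule: infinite_finite_induct)
  case (insert a A)
  then show ?case by (simp add: fps_logderiv_mult fps_prod_nth_0)
qed (auto simp: fps_logderiv_def)

lemma fps_logderiv_unique:
  assumes "fps_nth F 0 \<noteq> 0" "fps_deriv F = G * F"
  shows "fps_logderiv F = G"
proof -
  have "F * inverse F = 1" using assms inverse_mult_eq_1' by auto
  then show ?thesis using assms(2) by (simp add: fps_logderiv_def mult.assoc)
qed

text \<open>A geometric series: for v \<noteq> 0 the coefficients are minus the powers of the
  reciprocal of the root -u/v. Summed over linear factors they become power sums.\<close>

lemma fps_logderiv_linear:
  assumes "u \<noteq> 0"
  shows "fps_nth (fps_logderiv (fps_const u + fps_const v * fps_X)) n = - ((- v / u) ^ Suc n)"
proof -
  define G where "G = Abs_fps (\<lambda>n. - ((- v / u) ^ Suc n))"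
  have "fps_logderiv (fps_const u + fps_const v * fps_X) = G"
  proof (rule fps_logderiv_unique)
    show "fps_deriv (fps_const u + fps_const v * fps_X) = G * (fps_const u + fps_const v * fps_X)"
    proof (rule fps_ext)
      fix n
      have "fps_nth (G * (fps_const u + fps_const v * fps_X)) n =
              u * fps_nth G n + v * (if n = 0 then 0 else fps_nth G (n - 1))"
        by (simp add: distrib_left mult.commute[of G] mult.assoc)
      also have "\<dots> = (if n = 0 then v else 0)"
        using assms by (cases n) (auto simp: G_def field_simps)
      finally show "fps_nth (fps_deriv (fps_const u + fps_const v * fps_X)) n =
         fps_nth (G * (fps_const u + fps_const v * fps_X)) n" by simp
    qed
  qed (use assms in auto)
  then show ?thesis by (simp add: G_def)
qed

(* Blaschke factors remove the zeros in the disc without changing the modulus on its boundary;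
   the logarithm of the quotient is then controlled by the growth of f. *)
lemma power_sum_zeros_estimate:
  fixes f :: "complex \<Rightarrow> complex"
  assumes f: "f holomorphic_on UNIV" "f 0 = 1" "f has_fps_expansion F"
    and simple: "\<And>z. f z = 0 \<Longrightarrow> deriv f z \<noteq> 0"
    and R: "R > 0" and bd: "\<And>z. norm z = R \<Longrightarrow> norm (f z) \<le> exp B" and k: "k \<ge> 1"
    and r: "0 < r" "r \<le> R"
  shows "finite {a. f a = 0 \<and> norm a < R}"
    and "real (card {a. f a = 0 \<and> norm a < r}) * ln (R / r) \<le> B"
    and "norm ((\<Sum>a\<in>{a. f a = 0 \<and> norm a < R}. (1 / a) ^ k) + fps_nth (fps_logderiv F) (k - 1)) \<le>
          real (card {a. f a = 0 \<and> norm a < R}) / R ^ k + real k * (2 * (B + 1) * (2 / R) ^ k)"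
proof -
  define A where "A = {a. f a = 0 \<and> norm a < R}"
  have A_nz: "a \<noteq> 0" if "a \<in> A" for a using that f(2) by (auto simp: A_def)
  have A_zero: "f a = 0" if "a \<in> A" for a using that by (auto simp: A_def)
  have A_lt: "norm a < R" if "a \<in> A" for a using that by (auto simp: A_def)
  have finA: "finite A"
  proof (cases "f constant_on UNIV")
    case True
    then have "f z = 1" for z using f(2) by (metis UNIV_I constant_on_def)
    then show ?thesis by (simp add: A_def)
  next
    case False
    have "finite {z \<in> cball 0 R. f z = 0}"
      by (rule holomorphic_compact_finite_zeros[OF f(1)]) (use False in auto)
    then show ?thesis by (rule finite_subset[rotated]) (auto simp: A_def)
  qed
  then show "finite {a. f a = 0 \<and> norm a < R}" by (simp add: A_def)
  obtain g where g: "g holomorphic_on UNIV" "\<And>z. f z = (\<Prod>a\<in>A. z - a) * g z"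
    using entire_factor_zeros[OF f(1) finA A_zero] by blast
  \<comment> \<open>On |z| = R the factor q has the modulus of z - a, and its only possible zero is
    the mirror point of a outside the disc. So G is f with each z - a replaced by q.\<close>
  define q where "q a z = (of_real (R\<^sup>2) - cnj a * z) / of_real R" for a z
  define G where "G z = g z * (\<Prod>a\<in>A. q a z)" for z
  have holG: "G holomorphic_on S" for S
    unfolding G_def[abs_def] q_def[abs_def] using R
    by (intro holomorphic_intros holomorphic_on_subset[OF g(1)]) auto
  have fG: "f z * (\<Prod>a\<in>A. q a z) = (\<Prod>a\<in>A. z - a) * G z" for z
    by (simp add: G_def g(2))
  \<comment> \<open>A zero of g in the disc would be one of the points of A, hence a double zero of
    f.\<close>
  have g_nz: "g z \<noteq> 0" if z: "norm z < R" for z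
  proof
    assume gz: "g z = 0"
    then have fz: "f z = 0" by (simp add: g(2))
    then have "z \<in> A" using z by (simp add: A_def)
    have "((\<lambda>z. (\<Prod>a\<in>A. z - a) * g z) has_field_derivative
            deriv (\<lambda>z. \<Prod>a\<in>A. z - a) z * g z + deriv g z * (\<Prod>a\<in>A. z - a)) (at z)"
      by (intro DERIV_mult holomorphic_derivI[OF g(1)] holomorphic_derivI[of _ UNIV] holomorphic_intros) auto
    then have "(f has_field_derivative
            deriv (\<lambda>z. \<Prod>a\<in>A. z - a) z * g z + deriv g z * (\<Prod>a\<in>A. z - a)) (at z)"
      by (simp only: g(2)[abs_def])
    then have "deriv f z = deriv g z * (\<Prod>a\<in>A. z - a)"
      using gz by (simp add: DERIV_imp_deriv)
    also have "(\<Prod>a\<in>A. z - a) = 0" using finA \<open>z \<in> A\<close> by (intro prod_zero) auto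
    finally show False using simple[OF fz] by simp
  qed
  have q_nz: "q a z \<noteq> 0" if "a \<in> A" "norm z < R" for a z
  proof
    assume "q a z = 0"
    then have "of_real (R\<^sup>2) = cnj a * z" using R by (simp add: q_def)
    then have "norm (complex_of_real (R\<^sup>2)) = norm (cnj a * z)" by (rule arg_cong)
    then have "R * R = norm a * norm z" using R by (simp add: norm_mult power2_eq_square)
    moreover have "norm a * norm z < R * R"
      using A_lt[OF that(1)] that(2) by (intro mult_strict_mono) (auto intro: R)
    ultimately show False by simp
  qed
  have G_nz: "G z \<noteq> 0" if "norm z < R" for z
    using g_nz[OF that] q_nz[OF _ that] finA by (simp add: G_def)
  have q_bd: "norm (q a z) = norm (z - a)" if "norm z = R" for a z
  proof -
    have "of_real (R\<^sup>2) - cnj a * z = z * cnj (z - a)"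
      using complex_norm_square[of z] that by (simp add: algebra_simps del: of_real_power)
    then show ?thesis using that R by (simp add: q_def norm_divide norm_mult flip: complex_cnj_diff)
  qed
  have G_bd: "norm (G z) \<le> exp B" if "norm z \<le> R" for z
  proof (rule maximum_modulus_frontier[of G "cball 0 R"])
    show "continuous_on (closure (cball 0 R)) G"
      using holG by (intro holomorphic_on_imp_continuous_on)
    show "norm (G z) \<le> exp B" if "z \<in> frontier (cball 0 R)" for z
    proof -
      have z: "norm z = R" using that R by simp
      have "norm (\<Prod>a\<in>A. q a z) = norm (\<Prod>a\<in>A. z - a)" using q_bd[OF z] by (simp add: prod_norm[symmetric])
      then have "norm (G z) = norm (f z)" by (simp add: G_def g(2) norm_mult mult.commute)
      then show ?thesis using bd[OF z] by simp
    qed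
  qed (use holG that in auto)
  \<comment> \<open>Jensen's formula in multiplicative form. It gives |G(0)| >= 1, and estimating
    |a| by r in the small disc and by R elsewhere gives (R/r)^n <= |G(0)| for the number n of zeros
    in the small disc.\<close>
  have G0: "norm (G 0) * (\<Prod>a\<in>A. norm a) = R ^ card A"
  proof -
    have "norm (f 0) = (\<Prod>a\<in>A. norm a) * norm (g 0)"
      unfolding g(2)[of 0] by (simp add: norm_mult prod_norm[symmetric])
    then have 1: "(\<Prod>a\<in>A. norm a) * norm (g 0) = 1" using f(2) by simp
    have "norm (G 0) = norm (g 0) * R ^ card A"
      using R by (simp add: G_def q_def norm_mult prod_norm[symmetric] norm_divide power2_eq_square norm_power)
    then show ?thesis using 1 by (simp add: mult_ac)
  qed
  have prod_pos: "(\<Prod>a\<in>A. norm a) > 0" using A_nz by (intro prod_pos) auto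
  have G0_ge: "norm (G 0) \<ge> 1"
  proof -
    have "(\<Prod>a\<in>A. norm a) \<le> (\<Prod>a\<in>A. R)" by (intro prod_mono) (auto dest: A_lt)
    also have "\<dots> = norm (G 0) * (\<Prod>a\<in>A. norm a)" by (simp add: G0)
    finally show ?thesis using prod_pos by simp
  qed
  show "real (card {a. f a = 0 \<and> norm a < r}) * ln (R / r) \<le> B"
  proof -
    define A' where "A' = {a. f a = 0 \<and> norm a < r}"
    have A': "A' \<subseteq> A" using r by (auto simp: A_def A'_def)
    have finA': "finite A'" using finA A' finite_subset by blast
    have "(\<Prod>a\<in>A. norm a) = (\<Prod>a\<in>A'. norm a) * (\<Prod>a\<in>A - A'. norm a)"
      using prod.subset_diff[OF A' finA, of norm] by (simp add: mult.commute)
    also have "\<dots> \<le> (\<Prod>a\<in>A'. r) * (\<Prod>a\<in>A - A'. R)"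
      by (intro mult_mono prod_mono) (use r R in \<open>auto dest: A_lt simp: A'_def intro!: prod_nonneg intro: less_imp_le\<close>)
    also have "\<dots> = r ^ card A' * R ^ (card A - card A')"
      using card_Diff_subset[OF finA' A'] by simp
    finally have "R ^ card A \<le> norm (G 0) * (r ^ card A' * R ^ (card A - card A'))"
      unfolding G0[symmetric] by (intro mult_left_mono) auto
    also have "R ^ card A = R ^ card A' * R ^ (card A - card A')"
      using card_mono[OF finA A'] by (simp add: power_add[symmetric])
    finally have "R ^ card A' \<le> norm (G 0) * r ^ card A'" using R by (simp add: mult.assoc[symmetric])
    then have "(R / r) ^ card A' \<le> norm (G 0)" using r by (simp add: power_divide divide_le_eq)
    also have "\<dots> \<le> exp B" using G_bd[of 0] R by simp
    finally have "ln ((R / r) ^ card A') \<le> B"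
      using R r by (metis exp_gt_zero ln_exp ln_le_cancel_iff divide_pos_pos zero_less_power)
    then show ?thesis using R r by (simp add: ln_realpow A'_def)
  qed
  obtain H where H: "H holomorphic_on ball 0 R" "\<And>z. z \<in> ball 0 R \<Longrightarrow> exp (H z) = G z"
    by (rule holomorphic_logarithm_exists[of "ball 0 R" G 0]) (use holG G_nz R in auto)
  have "H analytic_on {0}" using H(1) R by (intro holomorphic_on_imp_analytic_at) auto
  then obtain FH where FH: "H has_fps_expansion FH" using analytic_at_imp_has_fps_expansion_0 by blast
  have "G analytic_on {0}" using holG[of UNIV] by (intro holomorphic_on_imp_analytic_at) auto
  then obtain FG where FG: "G has_fps_expansion FG" using analytic_at_imp_has_fps_expansion_0 by blast
  \<comment> \<open>The summand 1 makes the bound strict, as \<open>Borel_Caratheodory_coeff\<close>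
    demands.\<close>
  have H_Re: "Re (H z) < B + 1" if "norm z < R" for z
  proof -
    have "exp (Re (H z)) = norm (G z)" using H(2)[of z] that by (simp flip: norm_exp_eq_Re)
    also have "\<dots> \<le> exp B" using G_bd that by simp
    finally show ?thesis by simp
  qed
  have H_Re0: "Re (H 0) \<ge> 0"
  proof -
    have "exp 0 \<le> norm (G 0)" using G0_ge by simp
    also have "\<dots> = exp (Re (H 0))" using H(2)[of 0] R by (simp flip: norm_exp_eq_Re)
    finally show ?thesis by (simp only: exp_le_cancel_iff)
  qed
  have FG0: "fps_nth FG 0 \<noteq> 0" using fps_nth_fps_expansion[OF FG, of 0] G_nz[of 0] R by simp
  have dFG: "fps_deriv FG = fps_deriv FH * FG"
  proof (rule fps_expansion_unique_complex)
    show "deriv G has_fps_expansion fps_deriv FG" by (intro fps_expansion_intros FG)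
    have "(\<lambda>z. deriv H z * G z) has_fps_expansion fps_deriv FH * FG"
      by (intro fps_expansion_intros FG FH)
    moreover have "eventually (\<lambda>z. deriv H z * G z = deriv G z) (nhds 0)"
    proof -
      have "deriv H z * G z = deriv G z" if z: "z \<in> ball 0 R" for z
      proof -
        have "((\<lambda>z. exp (H z)) has_field_derivative exp (H z) * deriv H z) (at z)"
          using holomorphic_derivI[OF H(1) open_ball z] by (rule DERIV_fun_exp)
        then have "(G has_field_derivative exp (H z) * deriv H z) (at z)"
          by (rule has_field_derivative_transform_within_open[OF _ open_ball z H(2)])
        then show ?thesis using H(2)[OF z] by (simp add: DERIV_imp_deriv mult.commute)
      qed
      moreover have "eventually (\<lambda>z. z \<in> ball 0 R) (nhds (0::complex))"
        using R by (intro eventually_nhds_in_open) auto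
      ultimately show ?thesis by (auto elim: eventually_mono)
    qed
    ultimately show "deriv G has_fps_expansion fps_deriv FH * FG"
      by (auto simp: has_fps_expansion_def elim: eventually_elim2)
  qed
  define P where "P = (\<Prod>a\<in>A. fps_const (- a) + fps_const 1 * fps_X)"
  define Q where "Q = (\<Prod>a\<in>A. fps_const (of_real R) + fps_const (- cnj a / of_real R) * fps_X)"
  have Pe: "(\<lambda>z. \<Prod>a\<in>A. z - a) has_fps_expansion P"
  proof -
    have "(\<lambda>z. \<Prod>a\<in>A. - a + 1 * z) has_fps_expansion P"
      unfolding P_def by (intro fps_expansion_intros)
    then show ?thesis by simp
  qed
  have Qe: "(\<lambda>z. \<Prod>a\<in>A. q a z) has_fps_expansion Q"
  proof -
    have "(\<lambda>z. \<Prod>a\<in>A. of_real R + (- cnj a / of_real R) * z) has_fps_expansion Q"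
      unfolding Q_def by (intro fps_expansion_intros)
    moreover have "q a z = of_real R + (- cnj a / of_real R) * z" for a z
      using R by (simp add: q_def field_simps power2_eq_square)
    ultimately show ?thesis by simp
  qed
  \<comment> \<open>In the logarithmic derivatives the factors z - a contribute the power sum, the
    factors q an error of at most R^(-k) each, and G the coefficient of index k of its logarithm
    H.\<close>
  have FQ: "F * Q = P * FG"
  proof (rule fps_expansion_unique_complex)
    show "(\<lambda>z. f z * (\<Prod>a\<in>A. q a z)) has_fps_expansion F * Q"
      by (intro has_fps_expansion_mult f Qe)
    show "(\<lambda>z. f z * (\<Prod>a\<in>A. q a z)) has_fps_expansion P * FG"
      unfolding fG by (intro has_fps_expansion_mult Pe FG)
  qed
  have F0: "fps_nth F 0 \<noteq> 0" using fps_nth_fps_expansion[OF f(3), of 0] f(2) by simp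
  have P0: "fps_nth P 0 \<noteq> 0" using A_nz finA by (simp add: P_def fps_prod_nth_0)
  have Q0: "fps_nth Q 0 \<noteq> 0" using R finA by (simp add: Q_def fps_prod_nth_0)
  have "fps_logderiv F + fps_logderiv Q = fps_logderiv P + fps_logderiv FG"
    using arg_cong[OF FQ, of fps_logderiv] F0 P0 Q0 FG0 by (simp add: fps_logderiv_mult)
  also have "fps_logderiv FG = fps_deriv FH" by (rule fps_logderiv_unique[OF FG0 dFG])
  finally have eq: "fps_nth (fps_logderiv F) (k - 1) + fps_nth (fps_logderiv Q) (k - 1) =
     fps_nth (fps_logderiv P) (k - 1) + fps_nth (fps_deriv FH) (k - 1)"
    by (metis fps_add_nth)
  have sk: "Suc (k - Suc 0) = k" using k by simp
  have lin: "fps_nth (fps_logderiv (fps_const (- a) + fps_X)) n = - ((1 / a) ^ Suc n)" if "a \<noteq> 0" for a n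
    using fps_logderiv_linear[of "- a" 1 n] that by simp
  have "fps_nth (fps_logderiv P) (k - 1) = (\<Sum>a\<in>A. - ((1 / a) ^ k))"
    unfolding P_def using A_nz
    by (subst fps_logderiv_prod) (auto simp: fps_sum_nth lin sk simp del: power_Suc)
  moreover have "fps_nth (fps_logderiv Q) (k - 1) = (\<Sum>a\<in>A. - ((cnj a / of_real (R\<^sup>2)) ^ k))"
    unfolding Q_def using R
    by (subst fps_logderiv_prod)
       (auto simp: fps_sum_nth fps_logderiv_linear sk power2_eq_square simp del: power_Suc)
  moreover have "fps_nth (fps_deriv FH) (k - 1) = of_nat k * fps_nth FH k" using k by simp
  ultimately have "(\<Sum>a\<in>A. (1 / a) ^ k) + fps_nth (fps_logderiv F) (k - 1) =
      (\<Sum>a\<in>A. (cnj a / of_real (R\<^sup>2)) ^ k) + of_nat k * fps_nth FH k"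
    using eq by (simp add: sum_negf algebra_simps)
  also have "norm \<dots> \<le> (\<Sum>a\<in>A. 1 / R ^ k) + real k * (2 * (B + 1) * (2 / R) ^ k)"
  proof (rule order_trans[OF norm_triangle_ineq], intro add_mono)
    show "norm (\<Sum>a\<in>A. (cnj a / of_real (R\<^sup>2)) ^ k) \<le> (\<Sum>a\<in>A. 1 / R ^ k)"
    proof (rule order_trans[OF norm_sum], intro sum_mono)
      fix a assume a: "a \<in> A"
      have "norm (cnj a / of_real (R\<^sup>2)) \<le> 1 / R"
        using A_lt[OF a] R by (simp add: norm_divide norm_mult power2_eq_square divide_simps)
      then have "norm (cnj a / of_real (R\<^sup>2)) ^ k \<le> (1 / R) ^ k" by (intro power_mono) auto
      then show "norm ((cnj a / of_real (R\<^sup>2)) ^ k) \<le> 1 / R ^ k"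
        by (simp only: norm_power power_one_over)
    qed
    have "norm (fps_nth FH k) \<le> 2 * (B + 1) * (2 / R) ^ k"
      by (rule Borel_Caratheodory_coeff[OF H(1) R FH H_Re H_Re0 k])
    then show "norm (of_nat k * fps_nth FH k) \<le> real k * (2 * (B + 1) * (2 / R) ^ k)"
      by (simp add: norm_mult mult_left_mono)
  qed
  finally show "norm ((\<Sum>a\<in>{a. f a = 0 \<and> norm a < R}. (1 / a) ^ k) + fps_nth (fps_logderiv F) (k - 1)) \<le>
          real (card {a. f a = 0 \<and> norm a < R}) / R ^ k + real k * (2 * (B + 1) * (2 / R) ^ k)"
    by (simp add: A_def)
qed

text \<open>For exponential type both the growth bound and the number of zeros in the disc are O(R),
  so the error is O(R^(1-k)). It tends to 0 for k >= 2, whereas for k = 1 the estimate gives mere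
  boundedness.\<close>

lemma power_sum_zeros_limit:
  fixes f :: "complex \<Rightarrow> complex"
  assumes f: "f holomorphic_on UNIV" "f 0 = 1" "f has_fps_expansion F"
    and simple: "\<And>z. f z = 0 \<Longrightarrow> deriv f z \<noteq> 0"
    and growth: "M > 0" "D > 0" "\<And>z. norm (f z) \<le> M * exp (D * norm z)" and k: "k \<ge> 2"
  shows "(\<lambda>n. \<Sum>a\<in>{a. f a = 0 \<and> norm a < real n}. (1 / a) ^ k)
            \<longlonglongrightarrow> - fps_nth (fps_logderiv F) (k - 1)"
proof -
  define B where "B = (\<lambda>R::real. \<bar>ln M\<bar> + D * R)"
  have B: "norm (f z) \<le> exp (B R)" if "norm z = R" for z R
  proof -
    have "M * exp (D * R) = exp (ln M + D * R)" using growth(1) by (simp add: exp_add)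
    also have "\<dots> \<le> exp (B R)" by (simp add: B_def)
    finally show ?thesis using growth(3)[of z] that by simp
  qed
  \<comment> \<open>Counting inside the disc of twice the radius makes the logarithmic factor the
    constant ln 2.\<close>
  have card_le: "real (card {a. f a = 0 \<and> norm a < R}) \<le> B (2 * R) / ln 2" if "R > 0" for R
    using power_sum_zeros_estimate(2)[OF f simple, where R = "2 * R" and B = "B (2 * R)" and k = 1 and r = R] B that
    by (simp add: field_simps)
  define K where "K = real k * 2 * 2 ^ k"
  have K: "K \<ge> 0" by (simp add: K_def)
  define C0 where "C0 = \<bar>ln M\<bar> / ln 2 + K * (\<bar>ln M\<bar> + 1)"
  define C1 where "C1 = 2 * D / ln 2 + K * D"
  have est: "norm ((\<Sum>a\<in>{a. f a = 0 \<and> norm a < R}. (1 / a) ^ k) + fps_nth (fps_logderiv F) (k - 1)) \<le>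
       C0 * (1 / R ^ 2) + C1 * (1 / R)" if R: "R \<ge> 1" for R
  proof -
    have "norm ((\<Sum>a\<in>{a. f a = 0 \<and> norm a < R}. (1 / a) ^ k) + fps_nth (fps_logderiv F) (k - 1)) \<le>
       real (card {a. f a = 0 \<and> norm a < R}) / R ^ k + real k * (2 * (B R + 1) * (2 / R) ^ k)"
      by (rule power_sum_zeros_estimate(3)[OF f simple, where r = R]) (use R k B in auto)
    also have "\<dots> \<le> B (2 * R) / ln 2 / R ^ k + real k * (2 * (B R + 1) * (2 / R) ^ k)"
      using card_le[of R] R by (intro add_right_mono divide_right_mono) auto
    also have "\<dots> = (B (2 * R) / ln 2 + K * (B R + 1)) / R ^ k"
      by (simp add: K_def power_divide add_divide_distrib)
    also have "\<dots> \<le> (B (2 * R) / ln 2 + K * (B R + 1)) / R ^ 2"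
      using R k growth(2) K
      by (intro divide_left_mono power_increasing add_nonneg_nonneg mult_nonneg_nonneg divide_nonneg_nonneg)
         (auto simp: B_def)
    also have "\<dots> = (C0 + C1 * R) / R ^ 2"
      by (simp add: C0_def C1_def B_def algebra_simps add_divide_distrib)
    also have "\<dots> = C0 * (1 / R ^ 2) + C1 * (1 / R)"
      using R by (simp add: field_simps power2_eq_square)
    finally show ?thesis .
  qed
  have "((\<lambda>n. (\<Sum>a\<in>{a. f a = 0 \<and> norm a < real n}. (1 / a) ^ k) + fps_nth (fps_logderiv F) (k - 1)) \<longlongrightarrow> 0) sequentially"
  proof (rule Lim_null_comparison)
    show "eventually (\<lambda>n. norm ((\<Sum>a\<in>{a. f a = 0 \<and> norm a < real n}. (1 / a) ^ k) + fps_nth (fps_logderiv F) (k - 1)) \<le>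
       C0 * (1 / real n ^ 2) + C1 * (1 / real n)) sequentially"
      using eventually_ge_at_top[of 1] by eventually_elim (rule est, simp)
    have "(\<lambda>n. C0 * (1 / real n ^ 2) + C1 * (1 / real n)) \<longlonglongrightarrow> C0 * 0 + C1 * 0"
      by (intro tendsto_intros; real_asymp)
    then show "(\<lambda>n. C0 * (1 / real n ^ 2) + C1 * (1 / real n)) \<longlonglongrightarrow> 0" by simp
  qed
  from tendsto_add[OF this tendsto_const[of "- fps_nth (fps_logderiv F) (k - 1)"]] show ?thesis by simp
qed

section \<open>Zeros of the Coulomb wave function\<close>

lemma ladder_c_pos:
  assumes "2 * (L + real k) + 1 > 0 \<or> 2 * (L + real k) + 3 < 0"
  shows "ladder_c L \<eta> k > 0"
proof -
  have "1 + (\<eta> / (L + real k + 1))\<^sup>2 > 0" by (intro add_pos_nonneg) auto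
  moreover have "(2 * (L + real k) + 3) * (2 * (L + real k) + 1) > 0"
    using assms by (auto intro: mult_pos_pos mult_neg_neg)
  ultimately show ?thesis by (simp only: ladder_c_def lower_c_def lower_d_def divide_divide_eq_left) (rule divide_pos_pos)
qed

lemma ladder_c_neg:
  assumes "2 * (L + real k) + 1 < 0" "2 * (L + real k) + 3 > 0"
  shows "ladder_c L \<eta> k < 0"
proof -
  have "1 + (\<eta> / (L + real k + 1))\<^sup>2 > 0" by (intro add_pos_nonneg) auto
  moreover have "(2 * (L + real k) + 3) * (2 * (L + real k) + 1) < 0"
    using assms by (intro mult_pos_neg) auto
  ultimately show ?thesis by (simp only: ladder_c_def lower_c_def lower_d_def divide_divide_eq_left) (rule divide_pos_neg)
qed

text \<open>Here 2(L+k)+1 > 0 for all k >= 1, so the form is definite. The bound with s = 0 and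
  \<sigma> = 1 then excludes even a single zero above the axis, and conjugation those below.\<close>

lemma phi_real_zeros:
  assumes L: "admissible L \<eta>" "L > - 3/2" and z: "phi L \<eta> z = 0"
  shows "z \<in> \<real>"
proof -
  have h: "1 * ladder_weight L \<eta> k > 0" for k
    unfolding weight_def using L(2) by (simp, intro prod_pos) (auto intro!: ladder_c_pos)
  have no: "\<not> Im w > 0" if "phi L \<eta> w = 0" for w
    using card_upper_zeros_le[OF L(1), of "{w}" 0 1] h that by auto
  have "\<not> Im z > 0" "\<not> Im (cnj z) > 0" using no[OF z] no[of "cnj z"] z by (auto simp: phi_cnj)
  then show ?thesis by (simp add: complex_is_Real_iff)
qed

text \<open>\<open>Y k\<close> is the series of y k / y 0. The recurrence expresses coefficient n +
  1 of \<open>Y k\<close> through the coefficients n of its neighbours and itself, exactly as in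
  \<open>jacobi_power\<close>, and \<open>Y 0 = 1\<close> is the start vector.\<close>

lemma ladder_fps_coeff:
  assumes L: "admissible L \<eta>"
  shows "fps_nth (fps_X ^ k * coulomb_fps (L + real k) \<eta> * inverse (coulomb_fps L \<eta>)) n
           = of_real (jacobi_power (ladder_b L \<eta>) (ladder_c L \<eta>) n k)"
proof -
  define I where "I = inverse (coulomb_fps L \<eta>)"
  define Y where "Y k = fps_X ^ k * coulomb_fps (L + real k) \<eta> * I" for k
  have I: "coulomb_fps L \<eta> * I = 1" unfolding I_def by (rule inverse_mult_eq_1') simp
  have Y0: "Y 0 = 1" by (simp add: Y_def I)
  have rec: "fps_X * Y j = (1 + fps_const (of_real (ladder_b L \<eta> (Suc j))) * fps_X) * Y (Suc j)
       - fps_const (of_real (ladder_c L \<eta> (Suc j))) * fps_X * Y (Suc (Suc j))" for j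
  proof -
    let ?L = "L + real (Suc j)"
    have "coulomb_fps (L + real j) \<eta> = (1 + fps_const (of_real (lower_b ?L \<eta>)) * fps_X) * coulomb_fps ?L \<eta>
           - fps_const (of_real (lower_c ?L \<eta>)) * fps_X ^ 2 * coulomb_fps (L + real (Suc (Suc j))) \<eta>"
      using coulomb_fps_lower[of ?L \<eta>] admissible_add[OF L, of j] admissible_add[OF L, of "Suc j"]
      by (simp add: add_ac)
    then have "fps_X * Y j = fps_X ^ Suc j * ((1 + fps_const (of_real (lower_b ?L \<eta>)) * fps_X) * coulomb_fps ?L \<eta>
           - fps_const (of_real (lower_c ?L \<eta>)) * fps_X ^ 2 * coulomb_fps (L + real (Suc (Suc j))) \<eta>) * I"
      by (simp add: Y_def mult.assoc)
    also have "\<dots> = (1 + fps_const (of_real (lower_b ?L \<eta>)) * fps_X) * Y (Suc j)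
       - fps_const (of_real (lower_c ?L \<eta>)) * fps_X * Y (Suc (Suc j))"
      unfolding Y_def by (simp add: algebra_simps power2_eq_square del: of_nat_Suc)
    finally show ?thesis by (simp only: ladder_b_def ladder_c_def)
  qed
  have "fps_nth (Y k) n = of_real (jacobi_power (ladder_b L \<eta>) (ladder_c L \<eta>) n k)"
  proof (induction n arbitrary: k)
    case 0
    show ?case by (cases k) (simp_all add: Y0, simp add: Y_def)
  next
    case (Suc n)
    show ?case
    proof (cases k)
      case (Suc j)
      have "fps_nth (Y j) n = fps_nth (Y k) (Suc n) + of_real (ladder_b L \<eta> k) * fps_nth (Y k) n
              - of_real (ladder_c L \<eta> k) * fps_nth (Y (Suc k)) n"
        using arg_cong[OF rec[of j], of "\<lambda>F. fps_nth F (Suc n)"]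
        by (simp add: distrib_right mult.assoc Suc)
      then show ?thesis by (simp add: Suc Suc.IH[unfolded Suc] algebra_simps)
    qed (simp add: Y0)
  qed
  then show ?thesis by (simp only: Y_def I_def)
qed

text \<open>The logarithmic derivative is \<eta>/(L+1) - d y 1 / y 0 with d =
  \<open>lower_d L \<eta>\<close>. Its constant affects exponent 1 only, so exponents from 2 on see
  nothing but the moments.\<close>

lemma phi_power_sums:
  assumes L: "admissible L \<eta>"
  shows "(\<lambda>N. \<Sum>a\<in>{a. phi L \<eta> a = 0 \<and> norm a < real N}. (1 / a) ^ (n + 2))
    \<longlonglongrightarrow> of_real (lower_d L \<eta> * jacobi_power (ladder_b L \<eta>) (ladder_c L \<eta>) (Suc n) 1)"
proof -
  obtain M D where MD: "M > 0" "D > 0" "\<And>z. norm (phi L \<eta> z) \<le> M * exp (D * norm z)"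
    by (rule phi_growth) blast
  let ?F = "coulomb_fps L \<eta>"
  have F: "?F * inverse ?F = 1" by (rule inverse_mult_eq_1') simp
  have "fps_logderiv ?F = fps_const (of_real (\<eta> / (L + 1))) * (?F * inverse ?F)
     - fps_const (of_real (lower_d L \<eta>)) * (fps_X ^ 1 * coulomb_fps (L + real 1) \<eta> * inverse ?F)"
    unfolding fps_logderiv_def coulomb_fps_deriv[OF L] by (simp add: algebra_simps)
  then have "fps_nth (fps_logderiv ?F) (Suc n) =
      - of_real (lower_d L \<eta>) * fps_nth (fps_X ^ 1 * coulomb_fps (L + real 1) \<eta> * inverse ?F) (Suc n)"
    unfolding F by simp
  also note ladder_fps_coeff[OF L]
  finally have "- fps_nth (fps_logderiv ?F) (n + 2 - 1) =
      of_real (lower_d L \<eta> * jacobi_power (ladder_b L \<eta>) (ladder_c L \<eta>) (Suc n) 1)"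
    by (simp del: jacobi_power.simps)
  moreover have "(\<lambda>N. \<Sum>a\<in>{a. phi L \<eta> a = 0 \<and> norm a < real N}. (1 / a) ^ (n + 2))
      \<longlonglongrightarrow> - fps_nth (fps_logderiv ?F) (n + 2 - 1)"
    by (rule power_sum_zeros_limit[OF phi_holomorphic phi_0 phi_has_fps_expansion _ MD])
       (use phi_zeros_simple[OF L] in auto)
  ultimately show ?thesis by (simp only:)
qed

text \<open>Finitely many zeros would make the power sums satisfy the linear recurrence with
  characteristic polynomial p. Its coefficients would solve every Hankel row, although p is
  monic.\<close>

lemma infinite_zeros:
  assumes L: "admissible L \<eta>"
  shows "infinite {z. phi L \<eta> z = 0}"
proof
  define A where "A = {z. phi L \<eta> z = 0}"
  assume "finite {z. phi L \<eta> z = 0}"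
  then have fin: "finite A" by (simp add: A_def)
  let ?T = "\<lambda>n. jacobi_power (ladder_b L \<eta>) (ladder_c L \<eta>) (Suc n) 1"
  have d: "lower_d L \<eta> \<noteq> 0"
    using admissible_nz(2)[OF L, of 0] by (simp add: lower_d_def one_plus_square_nonzero)
  have ps: "(\<Sum>a\<in>A. (1 / a) ^ (n + 2)) = of_real (lower_d L \<eta> * ?T n)" for n
  proof (rule LIMSEQ_unique[OF _ phi_power_sums[OF L]])
    obtain K where K: "\<And>a. a \<in> A \<Longrightarrow> norm a < K"
      using finite_imp_bounded[OF fin] by (metis bounded_pos gt_ex le_less_trans)
    have "eventually (\<lambda>N. real N \<ge> K) sequentially" by real_asymp
    then have "eventually (\<lambda>N. (\<Sum>a\<in>A. (1 / a) ^ (n + 2)) =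
         (\<Sum>a\<in>{a. phi L \<eta> a = 0 \<and> norm a < real N}. (1 / a) ^ (n + 2))) sequentially"
    proof eventually_elim
      case (elim N)
      then have "{a. phi L \<eta> a = 0 \<and> norm a < real N} = A"
        using K by (force simp: A_def)
      then show ?case by simp
    qed
    then show "(\<lambda>N. \<Sum>a\<in>{a. phi L \<eta> a = 0 \<and> norm a < real N}. (1 / a) ^ (n + 2))
        \<longlonglongrightarrow> (\<Sum>a\<in>A. (1 / a) ^ (n + 2))"
      by (rule tendsto_eventually[OF eventually_mono]) simp
  qed
  define p where "p = (\<Prod>a\<in>A. [:- (1 / a), 1:])"
  have "degree p = (\<Sum>a\<in>A. degree [:- (1 / a), 1:])"
    unfolding p_def by (rule degree_prod_eq_sum_degree) auto
  then have deg: "degree p = card A" by simp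
  have lead: "coeff p (card A) = 1"
    using lead_coeff_prod[of "\<lambda>a. [:- (1 / a), 1:]" A] by (simp add: deg[symmetric] p_def[symmetric])
  have p0: "poly p (1 / a) = 0" if "a \<in> A" for a
    using that fin by (auto simp: p_def poly_prod)
  have H: "(\<Sum>i<Suc (card A). coeff p i * of_real (?T (i + j))) = 0" for j
  proof -
    have "of_real (lower_d L \<eta>) * (\<Sum>i<Suc (card A). coeff p i * of_real (?T (i + j))) =
       (\<Sum>i<Suc (card A). coeff p i * (\<Sum>a\<in>A. (1 / a) ^ (i + j + 2)))"
      unfolding ps by (simp add: sum_distrib_left mult_ac del: sum.lessThan_Suc)
    also have "\<dots> = (\<Sum>a\<in>A. (1 / a) ^ (j + 2) * poly p (1 / a))"
      unfolding poly_altdef deg sum_distrib_left lessThan_Suc_atMost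
      by (subst sum.swap) (simp add: power_add mult_ac)
    also have "\<dots> = 0" using p0 by simp
    finally show ?thesis using d by simp
  qed
  \<comment> \<open>The moments are real, so the real parts of the coefficients solve the same
    equations.\<close>
  have "Re (coeff p (card A)) = 0"
  proof (rule hankel_nondegenerate[where p = "Suc (card A)" and x = "\<lambda>i. Re (coeff p i)"])
    show "ladder_c L \<eta> k \<noteq> 0" if "k \<ge> 1" for k using ladder_c_nonzero[OF L that] .
    show "(\<Sum>i<Suc (card A). Re (coeff p i) * ?T (i + j)) = 0" for j
      using arg_cong[OF H[of j], of Re] by (simp only: Re_sum Re_complex_of_real times_complex.simps Im_complex_of_real) simp
  qed simp
  then show False by (simp add: lead)
qed

lemma card_upper_zeros_ge:
  assumes L: "admissible L \<eta>" "L < - 3/2" and s: "\<And>k. k \<ge> 1 \<Longrightarrow> k < s \<Longrightarrow> ladder_c L \<eta> k > 0"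
    and fin: "finite {z. phi L \<eta> z = 0 \<and> Im z > 0}"
  shows "s \<le> card {z. phi L \<eta> z = 0 \<and> Im z > 0}"
proof (rule ccontr)
  define U where "U = {z. phi L \<eta> z = 0 \<and> Im z > 0}"
  let ?T = "\<lambda>n. jacobi_power (ladder_b L \<eta>) (ladder_c L \<eta>) (Suc n) 1"
  assume "\<not> s \<le> card {z. phi L \<eta> z = 0 \<and> Im z > 0}"
  then have "card U < card {..<s}" by (simp add: U_def)
  \<comment> \<open>One real condition for each zero in the upper half plane, against s real
    unknowns. Conjugate zeros and real zeros add no condition because the coefficients are
    real.\<close>
  then obtain x :: "nat \<Rightarrow> real" where x: "\<exists>i\<in>{..<s}. x i \<noteq> 0"
      "\<forall>a\<in>U. (\<Sum>i<s. Im ((1 / a) ^ (i + 1)) * x i) = 0"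
    using homogeneous_system_nontrivial[of U "{..<s}" "\<lambda>a i. Im ((1 / a) ^ (i + 1))"] fin
    by (auto simp: U_def)
  \<comment> \<open>Starting at exponent 1 makes the square involve the exponents i + j + 2, which
    correspond to the moments of index i + j.\<close>
  define p where "p a = (\<Sum>i<s. of_real (x i) * (1 / a) ^ (i + 1))" for a :: complex
  have p_cnj: "p (cnj a) = cnj (p a)" for a by (simp add: p_def)
  have pU: "Im (p a) = 0" if "a \<in> U" for a
    using bspec[OF x(2) that] by (simp add: p_def mult.commute del: power_Suc)
  have p_real: "Im (p a) = 0" if "phi L \<eta> a = 0" for a
  proof -
    consider "Im a > 0" | "Im a < 0" | "Im a = 0" by linarith
    then show ?thesis
    proof cases
      case 1
      then show ?thesis using that pU by (simp add: U_def)
    next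
      case 2
      then have "cnj a \<in> U" using that by (simp add: U_def phi_cnj)
      then show ?thesis using pU[of "cnj a"] by (simp add: p_cnj)
    next
      case 3
      then have "cnj a = a" by (simp add: complex_eq_iff)
      then have "cnj (p a) = p a" using p_cnj[of a] by simp
      then show ?thesis by (simp add: complex_eq_iff)
    qed
  qed
  define Q where "Q = (\<Sum>j<s. \<Sum>i<s. x i * x j * ?T (i + j))"
  have "Q > 0"
    using hankel_positive[of s "ladder_c L \<eta>" _ x] s x(1) unfolding Q_def by blast
  have "(\<lambda>N. \<Sum>j<s. \<Sum>i<s. of_real (x i * x j) * (\<Sum>a\<in>{a. phi L \<eta> a = 0 \<and> norm a < real N}. (1 / a) ^ (i + j + 2)))
      \<longlonglongrightarrow> (\<Sum>j<s. \<Sum>i<s. of_real (x i * x j) * of_real (lower_d L \<eta> * ?T (i + j)))"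
    by (intro tendsto_sum tendsto_mult tendsto_const phi_power_sums L)
  also have "(\<Sum>j<s. \<Sum>i<s. of_real (x i * x j) * of_real (lower_d L \<eta> * ?T (i + j))) = complex_of_real (lower_d L \<eta> * Q)"
    by (simp add: Q_def sum_distrib_left mult_ac del: jacobi_power.simps)
  also have "(\<lambda>N. \<Sum>j<s. \<Sum>i<s. of_real (x i * x j) * (\<Sum>a\<in>{a. phi L \<eta> a = 0 \<and> norm a < real N}. (1 / a) ^ (i + j + 2)))
      = (\<lambda>N. \<Sum>a\<in>{a. phi L \<eta> a = 0 \<and> norm a < real N}. (p a)\<^sup>2)"
  proof
    fix N :: nat
    let ?Z = "{a. phi L \<eta> a = 0 \<and> norm a < real N}"
    have "(\<Sum>j<s. \<Sum>i<s. of_real (x i * x j) * (\<Sum>a\<in>?Z. (1 / a) ^ (i + j + 2)))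
      = (\<Sum>j<s. \<Sum>a\<in>?Z. \<Sum>i<s. (of_real (x i) * (1 / a) ^ (i + 1)) * (of_real (x j) * (1 / a) ^ (j + 1)))"
      by (simp add: sum_distrib_left, subst sum.swap, simp add: power_add mult_ac)
    also have "\<dots> = (\<Sum>a\<in>?Z. \<Sum>j<s. \<Sum>i<s. (of_real (x i) * (1 / a) ^ (i + 1)) * (of_real (x j) * (1 / a) ^ (j + 1)))"
      by (rule sum.swap)
    also have "\<dots> = (\<Sum>a\<in>?Z. (p a)\<^sup>2)"
      unfolding p_def power2_eq_square sum_product by (subst sum.swap) simp
    finally show "(\<Sum>j<s. \<Sum>i<s. of_real (x i * x j) * (\<Sum>a\<in>?Z. (1 / a) ^ (i + j + 2))) = (\<Sum>a\<in>?Z. (p a)\<^sup>2)" .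
  qed
  \<comment> \<open>The limit of sums of squares of real numbers cannot be negative, but Q > 0 and
    \<open>lower_d L \<eta>\<close> < 0.\<close>
  finally have "(\<lambda>N. Re (\<Sum>a\<in>{a. phi L \<eta> a = 0 \<and> norm a < real N}. (p a)\<^sup>2)) \<longlonglongrightarrow> Re (complex_of_real (lower_d L \<eta> * Q))"
    by (rule tendsto_Re)
  moreover have "Re (\<Sum>a\<in>{a. phi L \<eta> a = 0 \<and> norm a < real N}. (p a)\<^sup>2) \<ge> 0" for N
    unfolding Re_sum using p_real by (intro sum_nonneg) (simp add: power2_eq_square)
  ultimately have "Re (complex_of_real (lower_d L \<eta> * Q)) \<ge> 0"
    by (intro LIMSEQ_le_const) auto
  then have "lower_d L \<eta> * Q \<ge> 0" by simp
  moreover have "lower_d L \<eta> < 0"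
    unfolding lower_d_def using L(2) by (intro divide_pos_neg add_pos_nonneg) auto
  ultimately show False using \<open>Q > 0\<close> by (simp add: zero_le_mult_iff)
qed

lemma card_upper_zeros:
  assumes L: "admissible L \<eta>" "L < - 3/2"
  shows "finite {z. phi L \<eta> z = 0 \<and> Im z > 0}"
    and "int (card {z. phi L \<eta> z = 0 \<and> Im z > 0}) = \<lfloor>- L - 1/2\<rfloor>"
proof -
  define U where "U = {z. phi L \<eta> z = 0 \<and> Im z > 0}"
  define s where "s = nat \<lfloor>- L - 1/2\<rfloor>"
  have fl: "\<lfloor>- L - 1/2\<rfloor> \<ge> 1" using L(2) by linarith
  then have s: "int s = \<lfloor>- L - 1/2\<rfloor>" "s \<ge> 1" unfolding s_def by linarith+
  have "real s \<le> - L - 1/2" "- L - 1/2 < real s + 1"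
    using s(1) by linarith+
  \<comment> \<open>Admissibility excludes that -L - 1/2 is an integer, so both inequalities for s
    are strict.\<close>
  moreover have "2 * L + 3 + 2 * real (s - 1) \<noteq> 0" by (rule admissible_nz(2)[OF L(1)])
  ultimately have bounds: "2 * (L + real s) + 1 < 0" "2 * (L + real s) + 3 > 0"
    using s(2) by (auto simp: of_nat_diff)
  have pos: "ladder_c L \<eta> k > 0" if "k \<ge> 1" "k < s" for k
  proof (rule ladder_c_pos)
    have "real k + 1 \<le> real s" using that by linarith
    then have "2 * (L + real k) + 3 < 0" using bounds(1) unfolding distrib_left by linarith
    then show "2 * (L + real k) + 1 > 0 \<or> 2 * (L + real k) + 3 < 0" ..
  qed
  have pos': "ladder_c L \<eta> k > 0" if "k > s" for k
  proof (rule ladder_c_pos)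
    have "real s + 1 \<le> real k" using that by linarith
    then have "2 * (L + real k) + 1 > 0" using bounds(2) unfolding distrib_left by linarith
    then show "2 * (L + real k) + 1 > 0 \<or> 2 * (L + real k) + 3 < 0" ..
  qed
  \<comment> \<open>The single negative entry sits at index s. Weights are products over smaller
    indices, so the sign changes between s and s + 1.\<close>
  have neg: "ladder_c L \<eta> s < 0" by (rule ladder_c_neg[OF bounds])
  have wpos: "ladder_weight L \<eta> s > 0"
    unfolding weight_def by (intro prod_pos) (auto intro: pos)
  have wneg: "ladder_weight L \<eta> k < 0" if "k > s" for k
  proof -
    have "Suc s \<le> k" using that by simp
    then show ?thesis
    proof (induction k rule: dec_induct)
      case base
      show ?case using s(2) neg wpos by (simp add: weight_Suc mult_neg_pos)
    next
      case (step k)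
      then show ?case using pos'[of k] by (simp add: weight_Suc mult_pos_neg)
    qed
  qed
  \<comment> \<open>Stated for finite subsets, since it also has to yield the finiteness of
    U.\<close>
  have le: "card A \<le> s" if "finite A" "A \<subseteq> U" for A
  proof (rule card_upper_zeros_le[OF L(1) that(1)])
    show "Im a > 0 \<and> phi L \<eta> a = 0" if "a \<in> A" for a using that \<open>A \<subseteq> U\<close> by (auto simp: U_def)
    show "- 1 * ladder_weight L \<eta> k > 0" if "k > s" for k using wneg[OF that] by simp
  qed
  have fin: "finite U"
  proof (rule ccontr)
    assume "infinite U"
    then obtain A where "A \<subseteq> U" "finite A" "card A = Suc s"
      using infinite_arbitrarily_large by blast
    then show False using le by fastforce
  qed
  then show "finite {z. phi L \<eta> z = 0 \<and> Im z > 0}" by (simp add: U_def)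
  have "s \<le> card U"
    unfolding U_def by (rule card_upper_zeros_ge[OF L pos]) (use fin in \<open>auto simp: U_def\<close>)
  with le[OF fin] have "card U = s" by simp
  then show "int (card {z. phi L \<eta> z = 0 \<and> Im z > 0}) = \<lfloor>- L - 1/2\<rfloor>"
    using s(1) by (simp add: U_def)
qed

theorem theorem11:
  fixes \<eta> L :: real
  shows "((\<eta> \<noteq> 0 \<and> L > -3/2 \<and> L \<noteq> -1) \<or> (\<eta> = 0 \<and> L > -3/2)
            \<longrightarrow> (\<forall>\<rho>. coulomb_F L \<eta> \<rho> = 0 \<longrightarrow> \<rho> \<in> \<real>))
    \<and> (L < -3/2
         \<and> (\<eta> \<noteq> 0 \<longrightarrow> L \<notin> {- real n / 2 | n. n \<ge> 1})
         \<and> (\<eta> = 0 \<longrightarrow> L \<notin> {- real n - 1/2 | n. n \<ge> 1})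
       \<longrightarrow> (let Z = {\<rho>. coulomb_F L \<eta> \<rho> = 0 \<and> \<rho> \<notin> \<real>};
                pairs = {{\<rho>, cnj \<rho>} | \<rho>. \<rho> \<in> Z}
            in (\<forall>\<rho>\<in>Z. cnj \<rho> \<in> Z)
               \<and> finite pairs
               \<and> int (card pairs) = \<lfloor>- L - 1/2\<rfloor>)
           \<and> infinite {\<rho>. coulomb_F L \<eta> \<rho> = 0 \<and> \<rho> \<in> \<real>})"
proof (intro conjI impI)
  assume L: "(\<eta> \<noteq> 0 \<and> L > -3/2 \<and> L \<noteq> -1) \<or> (\<eta> = 0 \<and> L > -3/2)"
  have "2 * L + 2 \<notin> \<int>\<^sub>\<le>\<^sub>0" if "L > -3/2" "L \<noteq> -1"
  proof
    assume "2 * L + 2 \<in> \<int>\<^sub>\<le>\<^sub>0"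
    then obtain n where "2 * L + 2 = - real n" by (elim nonpos_Ints_cases') auto
    then show False using that by (cases n) auto
  qed
  moreover have "L + 3/2 \<notin> \<int>\<^sub>\<le>\<^sub>0" if "L > -3/2"
    using that nonpos_Ints_nonpos[of "L + 3/2"] by auto
  ultimately have adm: "admissible L \<eta>" using L by (auto simp: admissible_def)
  show "\<forall>\<rho>. coulomb_F L \<eta> \<rho> = 0 \<longrightarrow> \<rho> \<in> \<real>"
  proof (intro allI impI)
    fix \<rho> assume "coulomb_F L \<eta> \<rho> = 0"
    \<comment> \<open>At the origin \<open>coulomb_F\<close> is 0 by convention, but the origin is
      real.\<close>
    then show "\<rho> \<in> \<real>"
      using coulomb_F_zero_iff[OF adm, of \<rho>] phi_real_zeros[OF adm, of \<rho>] L
      by (cases "\<rho> = 0") auto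
  qed
next
  assume L: "L < -3/2
         \<and> (\<eta> \<noteq> 0 \<longrightarrow> L \<notin> {- real n / 2 | n. n \<ge> 1})
         \<and> (\<eta> = 0 \<longrightarrow> L \<notin> {- real n - 1/2 | n. n \<ge> 1})"
  have "2 * L + 2 \<notin> \<int>\<^sub>\<le>\<^sub>0" if "\<eta> \<noteq> 0"
  proof
    assume "2 * L + 2 \<in> \<int>\<^sub>\<le>\<^sub>0"
    then obtain n where "2 * L + 2 = - real n" by (elim nonpos_Ints_cases') auto
    then have "L = - real (n + 2) / 2" by simp
    then show False using L that by fastforce
  qed
  moreover have "L + 3/2 \<notin> \<int>\<^sub>\<le>\<^sub>0" if "\<eta> = 0"
  proof
    assume "L + 3/2 \<in> \<int>\<^sub>\<le>\<^sub>0"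
    then obtain n where "L + 3/2 = - real n" by (elim nonpos_Ints_cases') auto
    then have "L = - real (n + 1) - 1/2" by simp
    then show False using L that by fastforce
  qed
  ultimately have adm: "admissible L \<eta>" by (auto simp: admissible_def)
  have L': "L < - 3/2" using L by simp
  define U where "U = {z. phi L \<eta> z = 0 \<and> Im z > 0}"
  define Z where "Z = {\<rho>. coulomb_F L \<eta> \<rho> = 0 \<and> \<rho> \<notin> \<real>}"
  define pairs where "pairs = {{\<rho>, cnj \<rho>} | \<rho>. \<rho> \<in> Z}"
  have U: "finite U" "int (card U) = \<lfloor>- L - 1/2\<rfloor>"
    unfolding U_def by (rule card_upper_zeros[OF adm L'])+
  have Z: "z \<in> Z \<longleftrightarrow> phi L \<eta> z = 0 \<and> Im z \<noteq> 0" for z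
    using coulomb_F_zero_iff[OF adm, of z] by (cases "z = 0") (auto simp: Z_def complex_is_Real_iff)
  \<comment> \<open>Each pair has exactly one member in the upper half plane, so counting pairs is
    counting U.\<close>
  have pairs: "pairs = (\<lambda>z. {z, cnj z}) ` U"
  proof (intro equalityI subsetI)
    fix P assume "P \<in> pairs"
    then obtain z where z: "P = {z, cnj z}" "z \<in> Z" by (auto simp: pairs_def)
    show "P \<in> (\<lambda>z. {z, cnj z}) ` U"
    proof (cases "Im z > 0")
      case True
      then show ?thesis using z by (auto simp: Z U_def)
    next
      case False
      then have "cnj z \<in> U" using z by (simp add: Z U_def phi_cnj)
      then show ?thesis using z(1) by (intro image_eqI[of _ _ "cnj z"]) auto
    qed
  qed (auto simp: pairs_def Z U_def)
  have "inj_on (\<lambda>z. {z, cnj z}) U"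
    by (intro inj_onI) (auto simp: U_def doubleton_eq_iff)
  then have "card pairs = card U" by (simp add: pairs card_image)
  then have "int (card pairs) = \<lfloor>- L - 1/2\<rfloor>" using U by simp
  moreover have "finite pairs" using U by (simp add: pairs)
  moreover have "\<forall>z\<in>Z. cnj z \<in> Z" by (simp add: Z phi_cnj)
  ultimately show "let Z = {\<rho>. coulomb_F L \<eta> \<rho> = 0 \<and> \<rho> \<notin> \<real>};
                pairs = {{\<rho>, cnj \<rho>} | \<rho>. \<rho> \<in> Z}
            in (\<forall>\<rho>\<in>Z. cnj \<rho> \<in> Z)
               \<and> finite pairs
               \<and> int (card pairs) = \<lfloor>- L - 1/2\<rfloor>"
    unfolding Let_def Z_def pairs_def by blast
  show "infinite {\<rho>. coulomb_F L \<eta> \<rho> = 0 \<and> \<rho> \<in> \<real>}"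
  proof
    assume fin: "finite {\<rho>. coulomb_F L \<eta> \<rho> = 0 \<and> \<rho> \<in> \<real>}"
    \<comment> \<open>All zeros lie in the real ones together with the finite sets U and its
      conjugate, so finitely many real zeros would leave finitely many in total.\<close>
    have "{z. phi L \<eta> z = 0} \<subseteq> {\<rho>. coulomb_F L \<eta> \<rho> = 0 \<and> \<rho> \<in> \<real>} \<union> U \<union> cnj ` U"
    proof
      fix z assume "z \<in> {z. phi L \<eta> z = 0}"
      then have z: "phi L \<eta> z = 0" by simp
      then have "z \<noteq> 0" by auto
      consider "Im z = 0" | "Im z > 0" | "Im z < 0" by linarith
      then show "z \<in> {\<rho>. coulomb_F L \<eta> \<rho> = 0 \<and> \<rho> \<in> \<real>} \<union> U \<union> cnj ` U"
      proof cases
        case 1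
        then show ?thesis using z coulomb_F_zero_iff[OF adm \<open>z \<noteq> 0\<close>] by (simp add: complex_is_Real_iff)
      next
        case 2
        then show ?thesis using z by (simp add: U_def)
      next
        case 3
        then have "cnj z \<in> U" using z by (simp add: U_def phi_cnj)
        then show ?thesis by (metis UnI2 complex_cnj_cnj image_eqI)
      qed
    qed
    then have "finite {z. phi L \<eta> z = 0}"
      by (rule finite_subset) (use fin U(1) in auto)
    then show False using infinite_zeros[OF adm] by blast
  qed
qed

end
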